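(* (Weingarten's formula in terms of $\mathcal{B}_A$.) For $X\in T\Sigma$ and $A=1,\dots,p$ it holds that $$\gamma^2\,\bar\nabla_XN_A=-\mathcal{B}_A(X)+\sum_{B=1}^p\bar g\big(\mathcal{B}_B(N_A),X\big)N_B.$$
   Context: Setting: $n\ge 2$, $p\ge1$, $\Sigma$ is an $n$-dimensional manifold embedded in a Riemannian manifold $(M,\bar g)$ with $\dim M=m=n+p$. $x^1,\dots,x^m$ are local coordinates on $M$, $u^1,\dots,u^n$ local coordinates on $\Sigma$; the $x^i$ are regarded as functions of the $u^a$ (the embedding), and $\partial_a=\partial/\partial u^a$. Repeated indices are summed ($i,j,k$ from $1$ to $m$; $a,b$ from $1$ to $n$). $e_a=(\partial_ax^i)\partial_i$ is the basis of $T\Sigma\subset TM$, $g_{ab}=\bar g(e_a,e_b)$, $g=\det(g_{ab})$. $N_A=n_A^i\partial_i$, $A=1,\dots,p$, are (local, smooth) normal vector fields along $\Sigma$ with $\bar g(N_A,N_B)=\delta_{AB}$, $\bar g(N_A,e_a)=0$. $\bar\nabla$ is the Levi-Civita connection of $M$ with Christoffel symbols $\bar\Gamma^i_{jk}$, and $(\bar\nabla_aN_A)^i=\partial_an_A^i+\bar\Gamma^i_{jk}(\partial_ax^j)n_A^k$. $TM$ refers to tangent vectors of $M$ at points of $\Sigma$. $\rho$ is an arbitrary non-vanishing density on $\Sigma$, $\{f_1,\dots,f_n\}=\frac1\rho\varepsilon^{a_1\cdots a_n}(\partial_{a_1}f_1)\cdots(\partial_{a_n}f_n)$ with $\varepsilon$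 the Levi-Civita symbol ($\varepsilon^{12\cdots n}=1$), and $\gamma=\sqrt g/\rho$. For multi-indices $J=j_1\cdots j_{n-1}$, $\vec a=a_1\cdots a_{n-1}$: $\{f,\vec x^J\}=\{f,x^{j_1},\dots,x^{j_{n-1}}\}$, $\partial_{\vec a}\vec x^I=(\partial_{a_1}x^{i_1})\cdots(\partial_{a_{n-1}}x^{i_{n-1}})$, $\bar g_{IJ}=\bar g_{i_1j_1}\cdots\bar g_{i_{n-1}j_{n-1}}$. Define $$\mathcal{P}^{iJ}=\tfrac{1}{\sqrt{(n-1)!}}\{x^i,\vec x^J\},\quad \mathcal{T}_A^{Ij}=\tfrac{(-1)^n}{\sqrt{(n-1)!}}\tfrac{\varepsilon^{\vec a a}}{\rho}(\partial_{\vec a}\vec x^I)(\bar\nabla_aN_A)^j,\quad (\mathcal{B}_A)^{ik}=\mathcal{P}^{iI}(\mathcal{T}_A)^{Jk}\bar g_{IJ}.$$ $\mathcal{B}_A$ is viewed as a map $TM\to TM$ by lowering the second index with $\bar g$: $\mathcal{B}_A(X)^i=(\mathcal{B}_A)^{ik}\bar g_{kj}X^j$. *)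

theory Defs
  imports "HOL-Analysis.Analysis"
begin

section \<open>Smooth maps between coordinate spaces\<close>

definition partial :: "'n \<Rightarrow> (real^'n \<Rightarrow> 'v::real_normed_vector) \<Rightarrow> real^'n \<Rightarrow> 'v"
  where "partial a f u = frechet_derivative f (at u) (axis a 1)"

text \<open>Intended for open sets only: differentiability is differentiability at the points of
  \<open>U\<close>, and the partial derivatives are total functions that carry information only there.\<close>

primrec Ck_on :: "nat \<Rightarrow> (real^'n) set \<Rightarrow> (real^'n \<Rightarrow> 'v::real_normed_vector) \<Rightarrow> bool"
  where
    "Ck_on 0 U f \<longleftrightarrow> continuous_on U f"
  | "Ck_on (Suc k) U f \<longleftrightarrow> (\<forall>u\<in>U. f differentiable (at u)) \<and> (\<forall>a. Ck_on k U (partial a f))"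

definition smooth_on :: "(real^'n) set \<Rightarrow> (real^'n \<Rightarrow> 'v::real_normed_vector) \<Rightarrow> bool"
  where "smooth_on U f \<longleftrightarrow> (\<forall>k. Ck_on k U f)"

section \<open>Manifolds, Riemannian metrics and embeddings\<close>

text \<open>A chart consists of its domain and its coordinate map; values of the coordinate map
  outside the domain are irrelevant. The carrier of an atlas is the union of the domains, which is
  Hausdorff and second countable through the sort of the point type.\<close>

type_synonym ('a, 'n) chart = "'a set \<times> ('a \<Rightarrow> real^'n)"

definition chart_inv :: "('a, 'n::finite) chart \<Rightarrow> real^'n \<Rightarrow> 'a"
  where "chart_inv c = inv_into (fst c) (snd c)"

definition is_chart :: "('a::topological_space, 'n::finite) chart \<Rightarrow> bool"
  where "is_chart c \<longleftrightarrow> open (fst c) \<and> open (snd c ` fst c) \<and>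
    homeomorphism (fst c) (snd c ` fst c) (snd c) (chart_inv c)"

definition carrier_of :: "('a, 'n::finite) chart set \<Rightarrow> 'a set"
  where "carrier_of \<A> = \<Union> (fst ` \<A>)"

definition transition :: "('a, 'n::finite) chart \<Rightarrow> ('a, 'n) chart \<Rightarrow> real^'n \<Rightarrow> real^'n"
  where "transition c d = snd d \<circ> chart_inv c"

definition smooth_atlas ::
    "('a::{t2_space, second_countable_topology}, 'n::finite) chart set \<Rightarrow> bool"
  where "smooth_atlas \<A> \<longleftrightarrow> (\<forall>c\<in>\<A>. is_chart c) \<and>
    (\<forall>c\<in>\<A>. \<forall>d\<in>\<A>. smooth_on (snd c ` (fst c \<inter> fst d)) (transition c d))"

text \<open>A covariant 2-tensor field is given by its component matrix in every chart, as a function of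
  the coordinates in that chart; the last conjunct is the tensor transformation law.\<close>

definition riemannian_metric ::
    "('a::{t2_space, second_countable_topology}, 'm::finite) chart set
      \<Rightarrow> (('a, 'm) chart \<Rightarrow> real^'m \<Rightarrow> real^'m^'m) \<Rightarrow> bool"
  where "riemannian_metric \<A> G \<longleftrightarrow>
    (\<forall>c\<in>\<A>. smooth_on (snd c ` fst c) (G c) \<and>
      (\<forall>y\<in>snd c ` fst c. transpose (G c y) = G c y \<and> (\<forall>v. v \<noteq> 0 \<longrightarrow> v \<bullet> (G c y *v v) > 0))) \<and>
    (\<forall>c\<in>\<A>. \<forall>d\<in>\<A>. \<forall>y\<in>snd c ` (fst c \<inter> fst d).
      let J = jacobian (transition c d) (at y)
      in G c y = transpose J ** G d (transition c d y) ** J)"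

definition chart_rep ::
    "('s, 'n::finite) chart \<Rightarrow> ('a, 'm::finite) chart \<Rightarrow> ('s \<Rightarrow> 'a) \<Rightarrow> real^'n \<Rightarrow> real^'m"
  where "chart_rep s c \<iota> = snd c \<circ> \<iota> \<circ> chart_inv s"

definition chart_rep_dom ::
    "('s, 'n::finite) chart \<Rightarrow> ('a, 'm::finite) chart \<Rightarrow> ('s \<Rightarrow> 'a) \<Rightarrow> (real^'n) set"
  where "chart_rep_dom s c \<iota> = snd s ` (fst s \<inter> \<iota> -` fst c)"

definition smooth_embedding ::
    "('s::{t2_space, second_countable_topology}, 'n::finite) chart set
      \<Rightarrow> ('a::{t2_space, second_countable_topology}, 'm::finite) chart set \<Rightarrow> ('s \<Rightarrow> 'a) \<Rightarrow> bool"
  where "smooth_embedding \<S> \<M> \<iota> \<longleftrightarrow>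
    \<iota> ` carrier_of \<S> \<subseteq> carrier_of \<M> \<and>
    (\<exists>h. homeomorphism (carrier_of \<S>) (\<iota> ` carrier_of \<S>) \<iota> h) \<and>
    (\<forall>s\<in>\<S>. \<forall>c\<in>\<M>. smooth_on (chart_rep_dom s c \<iota>) (chart_rep s c \<iota>) \<and>
      (\<forall>u\<in>chart_rep_dom s c \<iota>. inj (frechet_derivative (chart_rep s c \<iota>) (at u))))"

section \<open>Submanifold geometry in local coordinates\<close>

text \<open>In this section \<open>x\<close> expresses the coordinates on the ambient manifold as functions of
  the coordinates \<open>u\<close> on the submanifold, and \<open>G\<close> is the metric matrix as a function of the ambient
  coordinates. Vectors along the submanifold are given by their ambient components.\<close>

definition metric_inner :: "real^'m^'m \<Rightarrow> real^'m \<Rightarrow> real^'m \<Rightarrow> real"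
  where "metric_inner g X Y = (\<Sum>i\<in>UNIV. \<Sum>j\<in>UNIV. g $ i $ j * X $ i * Y $ j)"

definition tangent_basis :: "(real^'n \<Rightarrow> real^'m) \<Rightarrow> 'n \<Rightarrow> real^'n \<Rightarrow> real^'m"
  where "tangent_basis x a u = (\<chi> i. partial a (\<lambda>u. x u $ i) u)"

definition induced_metric ::
    "(real^'n \<Rightarrow> real^'m) \<Rightarrow> (real^'m \<Rightarrow> real^'m^'m) \<Rightarrow> real^'n \<Rightarrow> real^'n^'n"
  where "induced_metric x G u =
    (\<chi> a b. metric_inner (G (x u)) (tangent_basis x a u) (tangent_basis x b u))"

text \<open>Christoffel symbols with upper index \<open>i\<close> and lower indices \<open>j\<close>, \<open>k\<close> of the Levi-Civita
  connection.\<close>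

definition christoffel :: "(real^'m \<Rightarrow> real^'m^'m) \<Rightarrow> real^'m \<Rightarrow> 'm \<Rightarrow> 'm \<Rightarrow> 'm \<Rightarrow> real"
  where "christoffel G y i j k = 1/2 * (\<Sum>l\<in>UNIV. matrix_inv (G y) $ i $ l *
    (partial j (\<lambda>y. G y $ l $ k) y + partial k (\<lambda>y. G y $ l $ j) y
      - partial l (\<lambda>y. G y $ j $ k) y))"

definition cov_deriv ::
    "(real^'n \<Rightarrow> real^'m) \<Rightarrow> (real^'m \<Rightarrow> real^'m^'m) \<Rightarrow> 'n \<Rightarrow> (real^'n \<Rightarrow> real^'m)
      \<Rightarrow> real^'n \<Rightarrow> real^'m"
  where "cov_deriv x G a V u = (\<chi> i. partial a (\<lambda>u. V u $ i) u +
    (\<Sum>j\<in>UNIV. \<Sum>k\<in>UNIV. christoffel G (x u) i j k * partial a (\<lambda>u. x u $ j) u * V u $ k))"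

text \<open>The covariant derivative in the direction of the tangent vector with components \<open>\<xi>\<close> in the
  coordinate basis \<open>tangent_basis x\<close>.\<close>

definition cov_deriv_dir ::
    "(real^'n \<Rightarrow> real^'m) \<Rightarrow> (real^'m \<Rightarrow> real^'m^'m) \<Rightarrow> real^'n \<Rightarrow> (real^'n \<Rightarrow> real^'m)
      \<Rightarrow> real^'n \<Rightarrow> real^'m"
  where "cov_deriv_dir x G \<xi> V u = (\<Sum>a\<in>UNIV. \<xi> $ a *\<^sub>R cov_deriv x G a V u)"

section \<open>The n-ary bracket and the tensors built from it\<close>

definition multi_indices :: "nat \<Rightarrow> 'k list set"
  where "multi_indices r = {I. length I = r}"

text \<open>The linear order on the index type plays the role of \<open>1 < 2 < \<dots> < n\<close>: the index \<open>b\<close> stands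
  for the position \<open>card {c. c < b}\<close>, counted from zero, in the list of indices. The strictly
  increasing list thus corresponds to the identity permutation.\<close>

definition levi_civita :: "'n::{finite, linorder} list \<Rightarrow> real"
  where "levi_civita as = (if length as = CARD('n) \<and> distinct as
    then of_int (sign (\<lambda>b::'n. as ! card {c. c < b})) else 0)"

definition bracket ::
    "(real^'n::{finite, linorder} \<Rightarrow> real) \<Rightarrow> (real^'n::_ \<Rightarrow> real) list \<Rightarrow> real^'n::_ \<Rightarrow> real"
  where "bracket \<rho> fs u = 1 / \<rho> u *
    (\<Sum>as\<in>multi_indices CARD('n). levi_civita as * (\<Prod>k<CARD('n). partial (as ! k) (fs ! k) u))"

definition tensorP ::
    "(real^'n::{finite, linorder} \<Rightarrow> real^'m) \<Rightarrow> (real^'n::_ \<Rightarrow> real) \<Rightarrow> 'm \<Rightarrow> 'm list \<Rightarrow> real^'n::_ \<Rightarrow> real"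
  where "tensorP x \<rho> i J u = 1 / sqrt (fact (CARD('n) - 1)) *
    bracket \<rho> ((\<lambda>u. x u $ i) # map (\<lambda>j u. x u $ j) J) u"

definition tensorT ::
    "(real^'n::{finite, linorder} \<Rightarrow> real^'m) \<Rightarrow> (real^'m \<Rightarrow> real^'m^'m) \<Rightarrow> (real^'n::_ \<Rightarrow> real)
      \<Rightarrow> (real^'n::_ \<Rightarrow> real^'m) \<Rightarrow> 'm list \<Rightarrow> 'm \<Rightarrow> real^'n::_ \<Rightarrow> real"
  where "tensorT x G \<rho> V I j u = (-1) ^ CARD('n) / sqrt (fact (CARD('n) - 1)) *
    (\<Sum>as\<in>multi_indices (CARD('n) - 1). \<Sum>a\<in>UNIV. levi_civita (as @ [a]) / \<rho> u *
      (\<Prod>k<CARD('n) - 1. partial (as ! k) (\<lambda>u. x u $ (I ! k)) u) * cov_deriv x G a V u $ j)"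

definition tensorB ::
    "(real^'n::{finite, linorder} \<Rightarrow> real^'m) \<Rightarrow> (real^'m \<Rightarrow> real^'m^'m) \<Rightarrow> (real^'n::_ \<Rightarrow> real)
      \<Rightarrow> (real^'n::_ \<Rightarrow> real^'m) \<Rightarrow> 'm \<Rightarrow> 'm \<Rightarrow> real^'n::_ \<Rightarrow> real"
  where "tensorB x G \<rho> V i k u =
    (\<Sum>I\<in>multi_indices (CARD('n) - 1). \<Sum>J\<in>multi_indices (CARD('n) - 1).
      tensorP x \<rho> i I u * tensorT x G \<rho> V J k u *
      (\<Prod>l<CARD('n) - 1. G (x u) $ (I ! l) $ (J ! l)))"

definition mapB ::
    "(real^'n::{finite, linorder} \<Rightarrow> real^'m) \<Rightarrow> (real^'m \<Rightarrow> real^'m^'m) \<Rightarrow> (real^'n::_ \<Rightarrow> real)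
      \<Rightarrow> (real^'n::_ \<Rightarrow> real^'m) \<Rightarrow> real^'n::_ \<Rightarrow> real^'m \<Rightarrow> real^'m"
  where "mapB x G \<rho> V u X =
    (\<chi> i. \<Sum>k\<in>UNIV. \<Sum>j\<in>UNIV. tensorB x G \<rho> V i k u * G (x u) $ k $ j * X $ j)"

definition density_ratio ::
    "(real^'n \<Rightarrow> real^'m) \<Rightarrow> (real^'m \<Rightarrow> real^'m^'m) \<Rightarrow> (real^'n \<Rightarrow> real) \<Rightarrow> real^'n \<Rightarrow> real"
  where "density_ratio x G \<rho> u = sqrt (det (induced_metric x G u)) / \<rho> u"

end

theory Submission
  imports Defs
begin

text \<open>
  The idea of the proof is to reduce \<^const>\<open>mapB\<close> to a formula in which only the covariant
  derivatives of the normal field and the induced metric occur, and to compare the two sides of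
  Weingarten's formula by pairing them with a frame. Write \<open>E\<^sub>a\<close> for the tangent basis,
  \<open>h\<close> for the induced metric and \<open>\<nabla>\<^sub>a\<close> for the covariant derivative.

  When the tensors \<open>P\<close> and \<open>T\<close> are multiplied and their multi-indices contracted with
  the ambient metric, each pair of tangent vectors becomes an entry of \<open>h\<close>. The two Levi-Civita
  symbols then assemble \<open>(n-1)!\<close> times the cofactor matrix of \<open>h\<close>
  (\<open>tensorB_eq\<close>, \<open>mapB_eq\<close>). By Laplace expansion
  (\<open>minor_sum_contraction\<close>) the cofactors contracted with \<open>h\<close> give \<open>det h\<close>, and
  \<open>det h / \<rho>\<^sup>2 = \<gamma>\<^sup>2\<close>. So for every vector \<open>Y\<close> the inner
  product \<open>\<langle>B\<^sub>A(Y), E\<^sub>c\<rangle>\<close> is \<open>-\<gamma>\<^sup>2 \<langle>\<nabla>\<^sub>c N\<^sub>A, Y\<rangle>\<close>, and \<open>B\<^sub>A(Y)\<close> is tangent to the submanifold (\<open>metric_inner_mapB_tangent\<close>,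
  \<open>metric_inner_mapB_normal\<close>).

  The covariant derivative is compatible with the metric (\<open>partial_metric_inner\<close>) and torsion
  free (\<open>cov_deriv_tangent_basis_commute\<close>). Differentiating the constant inner products of the
  frame therefore shows that \<open>\<langle>\<nabla>\<^sub>a N\<^sub>A, E\<^sub>b\<rangle>\<close> is symmetric in \<open>a\<close> and \<open>b\<close>, and
  that \<open>\<langle>\<nabla>\<^sub>a N\<^sub>A, N\<^sub>B\<rangle>\<close> is antisymmetric in \<open>A\<close> and \<open>B\<close>.

  Now let \<open>X\<close> be tangent. Pairing with \<open>E\<^sub>b\<close> kills the normal sum, and the symmetry
  identifies \<open>-\<langle>B\<^sub>A(X), E\<^sub>b\<rangle> = \<gamma>\<^sup>2 \<langle>\<nabla>\<^sub>b N\<^sub>A, X\<rangle>\<close> with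
  \<open>\<gamma>\<^sup>2 \<langle>\<nabla>\<^sub>X N\<^sub>A, E\<^sub>b\<rangle>\<close>. Pairing with \<open>N\<^sub>C\<close> kills \<open>B\<^sub>A(X)\<close>, and the
  antisymmetry identifies the coefficient \<open>\<langle>B\<^sub>C(N\<^sub>A), X\<rangle> = -\<gamma>\<^sup>2 \<langle>\<nabla>\<^sub>X N\<^sub>C, N\<^sub>A\<rangle>\<close>
  with \<open>\<gamma>\<^sup>2 \<langle>\<nabla>\<^sub>X N\<^sub>A, N\<^sub>C\<rangle>\<close>. The vectors \<open>E\<^sub>a\<close> and \<open>N\<^sub>B\<close> span the ambient
  tangent space (\<open>adapted_frame_spans\<close>), so the two sides agree.
\<close>

section \<open>The Levi-Civita symbol\<close>

text \<open>Lists are turned into functions on the index type through this enumeration, which is the one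
  that \<^const>\<open>levi_civita\<close> uses; a list of full length without repetitions becomes a permutation.\<close>

definition position :: "'n::{finite, linorder} \<Rightarrow> nat"
  where "position b = card {c. c < b}"

lemma bij_position: "bij_betw (position :: 'n::{finite, linorder} \<Rightarrow> nat) UNIV {..<CARD('n)}"
proof -
  have mono: "position b < position c" if "b < c" for b c :: 'n
    unfolding position_def using that by (intro psubset_card_mono) auto
  have inj: "inj (position :: 'n \<Rightarrow> nat)"
    by (rule linorder_injI) (use mono in force)
  have "position b < CARD('n)" for b :: 'n
    unfolding position_def by (intro psubset_card_mono) auto
  then have "range (position :: 'n \<Rightarrow> nat) \<subseteq> {..<CARD('n)}" by auto
  moreover have "card (range (position :: 'n \<Rightarrow> nat)) = card {..<CARD('n)}"
    using card_image[OF inj] by simp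
  ultimately have "range (position :: 'n \<Rightarrow> nat) = {..<CARD('n)}"
    by (intro card_subset_eq) auto
  with inj show ?thesis by (simp add: bij_betw_def)
qed

lemma position_less: "position (b :: 'n::{finite, linorder}) < CARD('n)"
  using bij_position by (auto simp: bij_betw_def)

lemma position_inject: "position b = position c \<longleftrightarrow> b = c"
  using bij_position by (auto simp: bij_betw_def inj_on_def)

lemma position_surj:
  "k < card (UNIV :: 'n::{finite, linorder} set) \<Longrightarrow> \<exists>b :: 'n. position b = k"
  using bij_position by (metis bij_betw_imp_surj_on imageE lessThan_iff)

lemma permutes_UNIV_iff_inj: "p permutes (UNIV :: 'n::finite set) \<longleftrightarrow> inj p"
proof
  assume "inj p"
  then have "bij p" by (simp add: bij_def finite_UNIV_inj_surj)
  then show "p permutes UNIV" by (simp add: permutes_def bij_iff)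
qed (rule permutes_inj)

lemma distinct_iff_inj_position:
  fixes as :: "'n::{finite, linorder} list"
  assumes "length as = CARD('n)"
  shows "distinct as \<longleftrightarrow> inj (\<lambda>b::'n. as ! position b)"
proof
  assume "distinct as"
  then show "inj (\<lambda>b::'n. as ! position b)"
    by (auto simp: inj_def nth_eq_iff_index_eq assms position_less position_inject)
next
  assume inj: "inj (\<lambda>b::'n. as ! position b)"
  show "distinct as"
    unfolding distinct_conv_nth assms
  proof (intro allI impI)
    fix i j assume "i < CARD('n)" "j < CARD('n)" "i \<noteq> j"
    then obtain b c :: 'n where "position b = i" "position c = j" "b \<noteq> c"
      by (metis position_surj)
    with inj show "as ! i \<noteq> as ! j" by (auto simp: inj_def)
  qed
qed

lemma levi_civita_eq_sign:
  fixes as :: "'n::{finite, linorder} list"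
  assumes "length as = CARD('n)"
  shows "levi_civita as = (if inj (\<lambda>b::'n. as ! position b)
    then of_int (sign (\<lambda>b::'n. as ! position b)) else 0)"
  unfolding levi_civita_def distinct_iff_inj_position[OF assms]
  using assms by (simp add: position_def)

text \<open>Read as functions of the position, the lists \<open>L\<close> that contribute are the permutations, so the
  sum is the Leibniz formula for the matrix whose rows are those of the transpose of \<open>M\<close> in the order \<open>R\<close>. If
  \<open>R\<close> is a permutation, its sign comes out; if \<open>R\<close> has a repetition, two rows agree and both sides
  vanish.\<close>

lemma levi_civita_determinant:
  fixes M :: "'n::{finite, linorder} \<Rightarrow> 'n \<Rightarrow> real" and R :: "'n list"
  assumes R: "length R = CARD('n)"
  shows "(\<Sum>L\<in>multi_indices CARD('n). levi_civita L * (\<Prod>k<CARD('n). M (L ! k) (R ! k)))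
    = levi_civita R * det (\<chi> a b. M a b)"
proof -
  define r where "r = (\<lambda>b::'n. R ! position b)"
  let ?f = "\<lambda>L :: 'n list. \<lambda>b::'n. L ! position b"
  let ?A = "(\<chi> b a. M a b) :: real^'n::_^'n::_"
  have fin: "finite (multi_indices CARD('n) :: 'n list set)"
    unfolding multi_indices_def using finite_lists_length_eq[of "UNIV::'n set"] by simp
  have bij: "bij_betw ?f {L \<in> multi_indices CARD('n). distinct L} {p. p permutes UNIV}"
  proof (rule bij_betw_imageI)
    show "inj_on ?f {L \<in> multi_indices CARD('n). distinct L}"
    proof (rule inj_onI)
      fix L K :: "'n list" assume *: "L \<in> {L \<in> multi_indices CARD('n). distinct L}"
        "K \<in> {L \<in> multi_indices CARD('n). distinct L}" "?f L = ?f K"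
      have "L ! k = K ! k" if "k < CARD('n)" for k
        using position_surj[OF that] fun_cong[OF *(3)] by metis
      with * show "L = K" by (intro nth_equalityI) (auto simp: multi_indices_def)
    qed
    show "?f ` {L \<in> multi_indices CARD('n). distinct L} = {p. p permutes UNIV}"
    proof (intro equalityI subsetI)
      fix p :: "'n \<Rightarrow> 'n" assume "p \<in> ?f ` {L \<in> multi_indices CARD('n). distinct L}"
      then show "p \<in> {p. p permutes UNIV}"
        by (auto simp: permutes_UNIV_iff_inj multi_indices_def distinct_iff_inj_position)
    next
      fix p :: "'n \<Rightarrow> 'n" assume "p \<in> {p. p permutes UNIV}"
      then have p: "inj p" by (simp add: permutes_UNIV_iff_inj)
      let ?L = "map (\<lambda>k. p (inv position k)) [0..<CARD('n)]"
      have inv: "inv position (position b) = b" for b :: 'n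
        by (rule inv_f_f) (simp add: inj_def position_inject)
      have "?f ?L = p" by (simp add: position_less inv)
      moreover from this have "distinct ?L"
        using p by (subst distinct_iff_inj_position) auto
      ultimately show "p \<in> ?f ` {L \<in> multi_indices CARD('n). distinct L}"
        by (intro image_eqI[of _ _ ?L]) (auto simp: multi_indices_def)
    qed
  qed
  have "(\<Sum>L\<in>multi_indices CARD('n). levi_civita L * (\<Prod>k<CARD('n). M (L ! k) (R ! k)))
    = (\<Sum>L\<in>{L \<in> multi_indices CARD('n). distinct L}.
        levi_civita L * (\<Prod>k<CARD('n). M (L ! k) (R ! k)))"
    by (rule sum.mono_neutral_right) (auto simp: fin levi_civita_def)
  also have "\<dots> = (\<Sum>L\<in>{L \<in> multi_indices CARD('n). distinct L}.
        of_int (sign (?f L)) * (\<Prod>b\<in>UNIV. M (?f L b) (r b)))"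
  proof (rule sum.cong[OF refl])
    fix L :: "'n list" assume L: "L \<in> {L \<in> multi_indices CARD('n). distinct L}"
    have "(\<Prod>k<CARD('n). M (L ! k) (R ! k)) = (\<Prod>b\<in>UNIV. M (?f L b) (r b))"
      unfolding r_def by (rule prod.reindex_bij_betw[OF bij_position, symmetric])
    with L show "levi_civita L * (\<Prod>k<CARD('n). M (L ! k) (R ! k))
      = of_int (sign (?f L)) * (\<Prod>b\<in>UNIV. M (?f L b) (r b))"
      by (auto simp: multi_indices_def levi_civita_eq_sign distinct_iff_inj_position)
  qed
  also have "\<dots> = (\<Sum>p\<in>{p. p permutes UNIV}. of_int (sign p) * (\<Prod>b\<in>UNIV. M (p b) (r b)))"
    by (rule sum.reindex_bij_betw[OF bij])
  also have "\<dots> = det (\<chi> b. ?A $ r b)"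
    by (simp add: det_def)
  also have "\<dots> = levi_civita R * det (\<chi> a b. M a b)"
  proof (cases "inj r")
    case True
    have "transpose ?A = (\<chi> a b. M a b)" by (simp add: transpose_def)
    then have "det ?A = det (\<chi> a b. M a b)" by (metis det_transpose)
    with True show ?thesis
      by (subst det_permute_rows)
        (auto simp: permutes_UNIV_iff_inj levi_civita_eq_sign[OF R] r_def)
  next
    case False
    then obtain b c where bc: "b \<noteq> c" "r b = r c" by (auto simp: inj_def)
    then have "det (\<chi> b. ?A $ r b) = 0"
      by (intro det_identical_rows[OF bc(1)]) (simp add: row_def)
    with False show ?thesis by (simp add: levi_civita_eq_sign[OF R] r_def)
  qed
  finally show ?thesis .
qed

text \<open>Exchanging neighbours in the list composes the associated function with a transposition.\<close>

lemma levi_civita_swap: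
  fixes xs ys :: "'n::{finite, linorder} list"
  shows "levi_civita (xs @ a # b # ys) = - levi_civita (xs @ b # a # ys)"
proof (cases "length (xs @ a # b # ys) = CARD('n)")
  case True
  let ?L = "xs @ a # b # ys" and ?K = "xs @ b # a # ys"
  have len: "length ?L = CARD('n)" "length ?K = CARD('n)" using True by auto
  obtain i j :: 'n where ij: "position i = length xs" "position j = Suc (length xs)"
    using True position_surj[of "length xs", where 'n = 'n]
      position_surj[of "Suc (length xs)", where 'n = 'n] by auto
  then have "i \<noteq> j" by auto
  let ?f = "\<lambda>d::'n. ?L ! position d" and ?t = "Transposition.transpose i j"
  have f: "(\<lambda>d::'n. ?K ! position d) = ?f \<circ> ?t"
  proof
    fix d
    consider "d = i" | "d = j" | "d \<noteq> i" "d \<noteq> j" by blast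
    then show "?K ! position d = (?f \<circ> ?t) d"
    proof cases
      case 3
      then have "position d \<noteq> length xs" "position d \<noteq> Suc (length xs)"
        using ij position_inject by metis+
      then show ?thesis using 3
        by (auto simp: nth_append nth_Cons' Transposition.transpose_def)
    qed (auto simp: ij nth_append)
  qed
  have inj: "inj (?f \<circ> ?t) \<longleftrightarrow> inj ?f"
  proof
    assume "inj (?f \<circ> ?t)"
    then have "inj ((?f \<circ> ?t) \<circ> ?t)" by (rule inj_compose) (rule inj_transpose)
    then show "inj ?f" by (simp add: comp_assoc)
  next
    assume "inj ?f"
    then show "inj (?f \<circ> ?t)" by (rule inj_compose) (rule inj_transpose)
  qed
  have "sign (?f \<circ> ?t) = - sign ?f" if "inj ?f"
  proof -
    have "permutation ?f" using that
      by (auto simp: permutation_permutes permutes_UNIV_iff_inj intro!: exI[of _ UNIV])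
    then show ?thesis using \<open>i \<noteq> j\<close>
      by (simp add: sign_compose permutation_swap_id sign_swap_id)
  qed
  then show ?thesis
    unfolding levi_civita_eq_sign[OF len(1)] levi_civita_eq_sign[OF len(2)] f inj by auto
next
  case False
  then show ?thesis by (auto simp: levi_civita_def)
qed

text \<open>The last index moves to the front past the entries of \<open>as\<close>, with one sign for each of them. The
  prefix \<open>xs\<close> is there for the induction; the case of interest is \<open>xs = []\<close>.\<close>

lemma levi_civita_rotate:
  fixes as :: "'n::{finite, linorder} list"
  shows "levi_civita (xs @ as @ [a]) = (-1) ^ length as * levi_civita (xs @ a # as)"
proof (induction as arbitrary: xs)
  case (Cons b as)
  show ?case using Cons[of "xs @ [b]"] levi_civita_swap[of xs b a as] by simp
qed simp

text \<open>The list \<open>bs\<close> of a nonzero term omits exactly one index, and both \<open>b\<close> and \<open>c\<close> must be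
  that index. For \<open>b = c\<close> every nonzero term is the square of a sign, and there is one for each
  ordering of the remaining indices.\<close>

lemma levi_civita_contraction:
  fixes b c :: "'n::{finite, linorder}"
  shows "(\<Sum>bs\<in>multi_indices (CARD('n) - 1). levi_civita (b # bs) * levi_civita (c # bs))
    = (if b = c then fact (CARD('n) - 1) else 0)"
proof (cases "b = c")
  case True
  let ?D = "{bs. length bs = CARD('n) - 1 \<and> distinct bs \<and> set bs \<subseteq> UNIV - {b}}"
  have fin: "finite (multi_indices (CARD('n) - 1) :: 'n list set)"
    unfolding multi_indices_def using finite_lists_length_eq[of "UNIV::'n set"] by simp
  have "card ?D = \<Prod>{card (UNIV - {b}) - (CARD('n) - 1) + 1 .. card (UNIV - {b})}"
    by (rule card_lists_distinct_length_eq) (auto simp: card_Diff_singleton)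
  also have "\<dots> = fact (CARD('n) - 1)" by (simp add: card_Diff_singleton fact_prod)
  finally have card: "card ?D = fact (CARD('n) - 1)" .
  have "(\<Sum>bs\<in>multi_indices (CARD('n) - 1). levi_civita (b # bs) * levi_civita (c # bs))
    = (\<Sum>bs\<in>?D. 1)"
  proof (rule sum.mono_neutral_cong_right[OF fin])
    show "?D \<subseteq> multi_indices (CARD('n) - 1)" by (auto simp: multi_indices_def)
    show "\<forall>i\<in>multi_indices (CARD('n) - 1) - ?D. levi_civita (b # i) * levi_civita (c # i) = 0"
      by (auto simp: multi_indices_def levi_civita_def)
    fix bs assume "bs \<in> ?D"
    then have "length (b # bs) = CARD('n) \<and> distinct (b # bs)" by auto
    then show "levi_civita (b # bs) * levi_civita (c # bs) = 1"
      using True by (simp add: levi_civita_def sign_idempotent flip: of_int_mult)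
  qed
  then show ?thesis using True card by simp
next
  case False
  have "levi_civita (b # bs) * levi_civita (c # bs) = 0" for bs
  proof (rule ccontr)
    assume "levi_civita (b # bs) * levi_civita (c # bs) \<noteq> 0"
    then have *: "length (b # bs) = CARD('n)" "distinct (b # bs)" "distinct (c # bs)"
      by (auto simp: levi_civita_def split: if_splits)
    then have "card (set (b # bs)) = CARD('n)" by (metis distinct_card)
    then have "set (b # bs) = UNIV" by (intro card_subset_eq) auto
    then have "c \<in> set (b # bs)" by auto
    then show False using * False by auto
  qed
  then show ?thesis using False by (simp only: if_False sum.neutral_const)
qed

section \<open>Partial derivatives\<close>

lemma Ck_on_subset: "Ck_on k U f \<Longrightarrow> V \<subseteq> U \<Longrightarrow> Ck_on k V f"
  by (induction k arbitrary: f) (auto intro: continuous_on_subset)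

lemma smooth_on_subset: "smooth_on U f \<Longrightarrow> V \<subseteq> U \<Longrightarrow> smooth_on V f"
  unfolding smooth_on_def using Ck_on_subset by blast

lemma smooth_on_partial: "smooth_on U f \<Longrightarrow> smooth_on U (partial a f)"
  unfolding smooth_on_def by (metis Ck_on.simps(2))

lemma smooth_on_differentiable: "smooth_on U f \<Longrightarrow> v \<in> U \<Longrightarrow> f differentiable (at v)"
  unfolding smooth_on_def by (metis Ck_on.simps(2))

lemma smooth_on_continuous: "smooth_on U f \<Longrightarrow> continuous_on U f"
  unfolding smooth_on_def by (metis Ck_on.simps(1))

lemma partial_eq: "(f has_derivative f') (at u) \<Longrightarrow> partial a f u = f' (axis a 1)"
  unfolding partial_def by (simp flip: frechet_derivative_at)

lemmas has_derivative_nth = bounded_linear.has_derivative[OF bounded_linear_vec_nth]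

lemma differentiable_nth: "f differentiable (at u) \<Longrightarrow> (\<lambda>v. f v $ i) differentiable (at u)"
  unfolding differentiable_def using has_derivative_nth[of f _ "at u" i] by blast

lemma partial_nth:
  "f differentiable (at u) \<Longrightarrow> partial a (\<lambda>v. f v $ i) u = partial a f u $ i"
  unfolding frechet_derivative_works
  using partial_eq[OF has_derivative_nth[of f "frechet_derivative f (at u)" "at u" i]]
  by (simp add: partial_def)

text \<open>Identities such as the symmetry of the metric or the orthonormality of the normal fields hold only
  on an open set of coordinates, while \<^const>\<open>partial\<close> acts on total functions; being local, it
  still respects them.\<close>

lemma partial_transform:
  assumes "f differentiable (at u)" "open U" "u \<in> U" "\<And>v. v \<in> U \<Longrightarrow> f v = g v"
  shows "partial a f u = partial a g u"
  unfolding partial_def using frechet_derivative_transform_within_open[OF assms] by simp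

lemma frechet_derivative_eq_sum_partial:
  fixes f :: "real^'n \<Rightarrow> 'v::real_normed_vector"
  assumes "f differentiable (at u)"
  shows "frechet_derivative f (at u) h = (\<Sum>a\<in>UNIV. h $ a *\<^sub>R partial a f u)"
proof -
  interpret D: bounded_linear "frechet_derivative f (at u)"
    using assms frechet_derivative_works has_derivative_bounded_linear by blast
  have "h = (\<Sum>a\<in>UNIV. h $ a *\<^sub>R axis a 1)"
    by (simp add: vec_eq_iff axis_def if_distrib cong: if_cong)
  then have "frechet_derivative f (at u) h = frechet_derivative f (at u) (\<Sum>a\<in>UNIV. h $ a *\<^sub>R axis a 1)"
    by simp
  then show ?thesis by (simp add: D.sum D.scaleR partial_def)
qed

lemma has_real_derivative_along_axis:
  assumes "f differentiable (at (p + s *\<^sub>R axis a 1))"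
  shows "((\<lambda>s. f (p + s *\<^sub>R axis a 1) $ i) has_real_derivative
    partial a f (p + s *\<^sub>R axis a 1) $ i) (at s)"
proof -
  let ?q = "p + s *\<^sub>R axis a 1"
  have f: "(f has_derivative frechet_derivative f (at ?q)) (at ?q)"
    using assms frechet_derivative_works by blast
  then interpret D: bounded_linear "frechet_derivative f (at ?q)"
    by (rule has_derivative_bounded_linear)
  have line: "((\<lambda>s. p + s *\<^sub>R axis a 1) has_derivative (\<lambda>t. t *\<^sub>R axis a 1)) (at s)"
    by (auto intro!: derivative_eq_intros)
  have "(\<lambda>t. frechet_derivative f (at ?q) (t *\<^sub>R axis a 1) $ i)
    = (*) (partial a f ?q $ i)"
    by (auto simp: D.scaleR partial_def fun_eq_iff)
  with has_derivative_nth[OF has_derivative_compose[OF line f], of i] show ?thesis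
    unfolding has_field_derivative_def by simp
qed

text \<open>The second difference of \<open>f\<close> over a square is evaluated by applying the mean value theorem
  in the direction \<open>a\<close> and then in the direction \<open>b\<close>. The left side is symmetric in \<open>a\<close>
  and \<open>b\<close>, which is what makes mixed partial derivatives commute.\<close>

lemma mixed_difference:
  fixes f :: "real^'n \<Rightarrow> real^'m"
  assumes "h > 0" and f: "smooth_on U f"
    and U: "\<And>s t. 0 \<le> s \<Longrightarrow> s \<le> h \<Longrightarrow> 0 \<le> t \<Longrightarrow> t \<le> h \<Longrightarrow>
      u + s *\<^sub>R axis a 1 + t *\<^sub>R axis b 1 \<in> U"
  obtains s t where "0 < s" "s < h" "0 < t" "t < h"
    "f (u + h *\<^sub>R axis a 1 + h *\<^sub>R axis b 1) $ i - f (u + h *\<^sub>R axis a 1) $ i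
      - f (u + h *\<^sub>R axis b 1) $ i + f u $ i
    = h * h * partial b (partial a f) (u + s *\<^sub>R axis a 1 + t *\<^sub>R axis b 1) $ i"
proof -
  let ?\<phi> = "\<lambda>s. f ((u + h *\<^sub>R axis b 1) + s *\<^sub>R axis a 1) $ i - f (u + s *\<^sub>R axis a 1) $ i"
  let ?\<phi>' = "\<lambda>s. partial a f ((u + h *\<^sub>R axis b 1) + s *\<^sub>R axis a 1) $ i
    - partial a f (u + s *\<^sub>R axis a 1) $ i"
  have "(?\<phi> has_real_derivative ?\<phi>' s) (at s)" if "0 \<le> s" "s \<le> h" for s
  proof (intro DERIV_diff has_real_derivative_along_axis smooth_on_differentiable[OF f])
    show "u + h *\<^sub>R axis b 1 + s *\<^sub>R axis a 1 \<in> U"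
      using U[of s h] that \<open>h > 0\<close> by (simp add: algebra_simps)
    show "u + s *\<^sub>R axis a 1 \<in> U" using U[of s 0] that \<open>h > 0\<close> by simp
  qed
  from MVT2[OF \<open>h > 0\<close>, of ?\<phi> ?\<phi>', OF this]
  obtain s where s: "0 < s" "s < h" "?\<phi> h - ?\<phi> 0 = h * ?\<phi>' s" by auto
  let ?\<psi> = "\<lambda>t. partial a f ((u + s *\<^sub>R axis a 1) + t *\<^sub>R axis b 1) $ i"
  let ?\<psi>' = "\<lambda>t. partial b (partial a f) ((u + s *\<^sub>R axis a 1) + t *\<^sub>R axis b 1) $ i"
  have "(?\<psi> has_real_derivative ?\<psi>' t) (at t)" if "0 \<le> t" "t \<le> h" for t
    by (intro has_real_derivative_along_axis smooth_on_differentiable[OF smooth_on_partial[OF f]])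
      (use U[of s t] that s in auto)
  from MVT2[OF \<open>h > 0\<close>, of ?\<psi> ?\<psi>', OF this]
  obtain t where t: "0 < t" "t < h" "?\<psi> h - ?\<psi> 0 = h * ?\<psi>' t" by auto
  have "?\<phi>' s = ?\<psi> h - ?\<psi> 0"
    by (simp add: add.assoc add.commute[of "h *\<^sub>R axis b 1"])
  with s(3) t(3) have "?\<phi> h - ?\<phi> 0 = h * (h * ?\<psi>' t)" by metis
  then have "f (u + h *\<^sub>R axis a 1 + h *\<^sub>R axis b 1) $ i - f (u + h *\<^sub>R axis a 1) $ i
      - f (u + h *\<^sub>R axis b 1) $ i + f u $ i = h * h * ?\<psi>' t"
    by (simp add: add.assoc add.commute[of "h *\<^sub>R axis b 1"])
  then show ?thesis using s(1,2) t(1,2) by (intro that) 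
qed

text \<open>Schwarz's theorem. Both mixed derivatives, at suitable points arbitrarily close to \<open>u\<close>,
  equal the same second difference divided by the area of the square, so continuity makes them equal
  at \<open>u\<close>.\<close>

lemma partial_commute:
  fixes f :: "real^'n \<Rightarrow> real^'m"
  assumes U: "open U" "u \<in> U" and f: "smooth_on U f"
  shows "partial a (partial b f) u = partial b (partial a f) u"
proof -
  have "dist (partial a (partial b f) u $ i) (partial b (partial a f) u $ i) \<le> e"
    if "e > 0" for i e
  proof -
    have near: "\<exists>d>0. \<forall>v. dist v u < d \<longrightarrow> dist (partial c (partial c' f) v $ i) (partial c (partial c' f) u $ i) < e / 2"
      for c c'
    proof -
      have "continuous_on U (\<lambda>v. partial c (partial c' f) v $ i)"
        by (intro continuous_intros smooth_on_continuous smooth_on_partial f)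
      then have "continuous (at u) (\<lambda>v. partial c (partial c' f) v $ i)"
        unfolding continuous_on_eq_continuous_at[OF U(1)] using U(2) by (rule bspec)
      then show ?thesis
        unfolding continuous_at_eps_delta
        using \<open>e > 0\<close> by (elim allE[of _ "e / 2"]) (simp only: half_gt_zero_iff simp_thms)
    qed
    obtain d1 where d1: "d1 > 0" "\<And>v. dist v u < d1 \<Longrightarrow>
      dist (partial a (partial b f) v $ i) (partial a (partial b f) u $ i) < e / 2" using near[of a b] by (elim exE conjE) simp
    obtain d2 where d2: "d2 > 0" "\<And>v. dist v u < d2 \<Longrightarrow>
      dist (partial b (partial a f) v $ i) (partial b (partial a f) u $ i) < e / 2" using near[of b a] by (elim exE conjE) simp
    obtain d3 where d3: "d3 > 0" "ball u d3 \<subseteq> U" using openE[OF U] .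
    \<comment> \<open>A side of a third of the smallest radius keeps the closed square inside all three balls.\<close>
    define h where "h = min d1 (min d2 d3) / 3"
    have h: "h > 0" "3 * h \<le> d1" "3 * h \<le> d2" "3 * h \<le> d3" using d1(1) d2(1) d3(1) by (auto simp: h_def)
    have dist: "dist (u + s *\<^sub>R axis c 1 + t *\<^sub>R axis c' 1) u < 3 * h"
      if "0 \<le> s" "s \<le> h" "0 \<le> t" "t \<le> h" for s t and c c' :: 'n
    proof -
      have "dist (u + s *\<^sub>R axis c 1 + t *\<^sub>R axis c' 1) u \<le> norm (s *\<^sub>R axis c 1 :: real^'n) + norm (t *\<^sub>R axis c' 1 :: real^'n)"
        unfolding dist_norm add.assoc add_diff_cancel_left' by (rule norm_triangle_ineq)
      then show ?thesis using that h(1) by (simp add: norm_axis_1)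
    qed
    have in_U: "u + s *\<^sub>R axis c 1 + t *\<^sub>R axis c' 1 \<in> U"
      if "0 \<le> s" "s \<le> h" "0 \<le> t" "t \<le> h" for s t and c c' :: 'n
    proof -
      have "u + s *\<^sub>R axis c 1 + t *\<^sub>R axis c' 1 \<in> ball u d3"
        unfolding mem_ball dist_commute[of u] using dist[OF that] h(4) by (rule less_le_trans)
      then show ?thesis using d3(2) by blast
    qed
    have difference: "\<exists>s t. 0 < s \<and> s < h \<and> 0 < t \<and> t < h \<and>
      f (u + h *\<^sub>R axis c 1 + h *\<^sub>R axis c' 1) $ i - f (u + h *\<^sub>R axis c 1) $ i
      - f (u + h *\<^sub>R axis c' 1) $ i + f u $ i
      = h * h * partial c' (partial c f) (u + s *\<^sub>R axis c 1 + t *\<^sub>R axis c' 1) $ i" for c c'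
      by (rule mixed_difference[OF h(1) f, of u c c' i]) (rule in_U, assumption+, blast)
    obtain s t where st: "0 < s" "s < h" "0 < t" "t < h"
      "f (u + h *\<^sub>R axis a 1 + h *\<^sub>R axis b 1) $ i - f (u + h *\<^sub>R axis a 1) $ i
      - f (u + h *\<^sub>R axis b 1) $ i + f u $ i
      = h * h * partial b (partial a f) (u + s *\<^sub>R axis a 1 + t *\<^sub>R axis b 1) $ i"
      using difference[of a b] by (elim exE conjE)
    obtain s' t' where st': "0 < s'" "s' < h" "0 < t'" "t' < h"
      "f (u + h *\<^sub>R axis b 1 + h *\<^sub>R axis a 1) $ i - f (u + h *\<^sub>R axis b 1) $ i
      - f (u + h *\<^sub>R axis a 1) $ i + f u $ i
      = h * h * partial a (partial b f) (u + s' *\<^sub>R axis b 1 + t' *\<^sub>R axis a 1) $ i"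
      using difference[of b a] by (elim exE conjE)
    have "f (u + h *\<^sub>R axis b 1 + h *\<^sub>R axis a 1) $ i = f (u + h *\<^sub>R axis a 1 + h *\<^sub>R axis b 1) $ i"
      by (simp add: add_ac)
    then have "h * h * partial b (partial a f) (u + s *\<^sub>R axis a 1 + t *\<^sub>R axis b 1) $ i
      = h * h * partial a (partial b f) (u + s' *\<^sub>R axis b 1 + t' *\<^sub>R axis a 1) $ i"
      using st(5) st'(5) by linarith
    then have eq: "partial b (partial a f) (u + s *\<^sub>R axis a 1 + t *\<^sub>R axis b 1) $ i
      = partial a (partial b f) (u + s' *\<^sub>R axis b 1 + t' *\<^sub>R axis a 1) $ i"
      using h(1) by simp
    have 1: "dist (partial b (partial a f) (u + s *\<^sub>R axis a 1 + t *\<^sub>R axis b 1) $ i) (partial b (partial a f) u $ i) < e / 2"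
      using st by (intro d2(2) less_le_trans[OF dist h(3)]) auto
    have 2: "dist (partial a (partial b f) (u + s' *\<^sub>R axis b 1 + t' *\<^sub>R axis a 1) $ i) (partial a (partial b f) u $ i) < e / 2"
      using st' by (intro d1(2) less_le_trans[OF dist h(2)]) auto
    show ?thesis using 1 2 unfolding eq dist_real_def by linarith
  qed
  then have "dist (partial a (partial b f) u $ i) (partial b (partial a f) u $ i) \<le> 0" for i
    by (rule field_le_epsilon) simp
  then show ?thesis by (simp add: vec_eq_iff)
qed

section \<open>Inner products and Gram determinants\<close>

lemma metric_inner_eq: "metric_inner g X Y = X \<bullet> (g *v Y)"
  by (simp add: metric_inner_def inner_vec_def matrix_vector_mult_def sum_distrib_left mult_ac)

lemma metric_inner_commute: "transpose g = g \<Longrightarrow> metric_inner g X Y = metric_inner g Y X"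
  unfolding metric_inner_eq by (metis dot_lmul_matrix inner_commute transpose_matrix_vector)

lemma metric_inner_add_left: "metric_inner g (X + Y) Z = metric_inner g X Z + metric_inner g Y Z"
  and metric_inner_diff_left: "metric_inner g (X - Y) Z = metric_inner g X Z - metric_inner g Y Z"
  and metric_inner_scaleR_left: "metric_inner g (r *\<^sub>R X) Z = r * metric_inner g X Z"
  and metric_inner_sum_left: "metric_inner g (\<Sum>i\<in>I. F i) Z = (\<Sum>i\<in>I. metric_inner g (F i) Z)"
  unfolding metric_inner_eq by (simp_all add: inner_add_left inner_diff_left inner_sum_left)

lemma metric_inner_add_right: "metric_inner g X (Y + Z) = metric_inner g X Y + metric_inner g X Z"
  and metric_inner_scaleR_right: "metric_inner g X (r *\<^sub>R Z) = r * metric_inner g X Z"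
  and metric_inner_sum_right: "metric_inner g X (\<Sum>i\<in>I. F i) = (\<Sum>i\<in>I. metric_inner g X (F i))"
  unfolding metric_inner_eq
  by (simp_all add: inner_sum_right inner_add_right linear_sum matrix_vector_right_distrib
    matrix_vector_mult_scaleR)

lemmas metric_inner_left = metric_inner_add_left metric_inner_diff_left
  metric_inner_scaleR_left metric_inner_sum_left

text \<open>The segment from \<open>h\<close> to the identity consists, apart from its endpoint \<open>h\<close>, of
  positive definite and hence invertible matrices. The determinant is \<open>1\<close> at the identity and
  cannot change sign on the way, so it is not negative at \<open>h\<close>.\<close>

lemma det_nonneg:
  fixes h :: "real^'n^'n"
  assumes "\<And>v. 0 \<le> v \<bullet> (h *v v)"
  shows "0 \<le> det h"
proof (rule ccontr)
  assume neg: "\<not> 0 \<le> det h"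
  define q where "q t = det (t *\<^sub>R mat 1 + (1 - t) *\<^sub>R h)" for t :: real
  have "continuous_on {0..1} q"
    unfolding q_def det_def by (auto intro!: continuous_intros simp: mat_def)
  moreover have "q 0 < 0" "q 1 = 1" using neg by (auto simp: q_def)
  ultimately obtain t where t: "0 \<le> t" "t \<le> 1" "q t = 0"
    using IVT'[of q 0 0 1] by auto
  with \<open>q 0 < 0\<close> have "t > 0" by (cases "t = 0") auto
  have "v = 0" if "(t *\<^sub>R mat 1 + (1 - t) *\<^sub>R h) *v v = 0" for v
  proof -
    have "t *\<^sub>R v + (1 - t) *\<^sub>R (h *v v) = 0"
      using that by (simp add: matrix_vector_mult_add_rdistrib flip: scaleR_matrix_vector_assoc)
    then have "v \<bullet> (t *\<^sub>R v + (1 - t) *\<^sub>R (h *v v)) = 0" by simp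
    then have "t * (v \<bullet> v) + (1 - t) * (v \<bullet> (h *v v)) = 0" by (simp add: inner_add_right)
    moreover have "(1 - t) * (v \<bullet> (h *v v)) \<ge> 0" using t(2) assms by simp
    moreover have "t * (v \<bullet> v) \<ge> 0" using t(1) by simp
    ultimately have "t * (v \<bullet> v) = 0" by linarith
    with \<open>t > 0\<close> show "v = 0" by simp
  qed
  then have "invertible (t *\<^sub>R mat 1 + (1 - t) *\<^sub>R h)"
    unfolding invertible_left_inverse matrix_left_invertible_ker by blast
  with t(3) show False by (simp add: q_def invertible_det_nz)
qed

section \<open>Contraction over multi-indices\<close>

lemma multi_indices_0: "multi_indices 0 = {[]}"
  by (simp add: multi_indices_def)

lemma sum_multi_indices_Suc:
  "(\<Sum>L\<in>multi_indices (Suc r). F L) = (\<Sum>a\<in>(UNIV :: 'k::finite set). \<Sum>as\<in>multi_indices r. F (a # as))"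
proof -
  have "multi_indices (Suc r) = (\<lambda>(a :: 'k, as). a # as) ` (UNIV \<times> multi_indices r)"
    by (auto simp: multi_indices_def length_Suc_conv)
  then show ?thesis
    by (simp add: sum.reindex inj_on_def sum.cartesian_product case_prod_unfold)
qed

lemma sum_multi_indices_prod:
  fixes f :: "nat \<Rightarrow> 'k::finite \<Rightarrow> 'k \<Rightarrow> real"
  shows "(\<Sum>I\<in>multi_indices r. \<Sum>J\<in>multi_indices r. \<Prod>l<r. f l (I ! l) (J ! l))
    = (\<Prod>l<r. \<Sum>i\<in>UNIV. \<Sum>j\<in>UNIV. f l i j)"
proof (induction r arbitrary: f)
  case 0
  then show ?case by (simp add: multi_indices_0)
next
  case (Suc r)
  have "(\<Sum>I\<in>multi_indices (Suc r). \<Sum>J\<in>multi_indices (Suc r). \<Prod>l<Suc r. f l (I ! l) (J ! l))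
    = (\<Sum>i\<in>UNIV. \<Sum>I\<in>multi_indices r. \<Sum>j\<in>UNIV. \<Sum>J\<in>multi_indices r.
        f 0 i j * (\<Prod>l<r. f (Suc l) (I ! l) (J ! l)))"
    unfolding sum_multi_indices_Suc prod.lessThan_Suc_shift by simp
  also have "\<dots> = (\<Sum>i\<in>UNIV. \<Sum>j\<in>UNIV. \<Sum>I\<in>multi_indices r. \<Sum>J\<in>multi_indices r.
        f 0 i j * (\<Prod>l<r. f (Suc l) (I ! l) (J ! l)))"
    by (intro sum.cong refl sum.swap)
  also have "\<dots> = (\<Sum>i\<in>UNIV. \<Sum>j\<in>UNIV. f 0 i j) * (\<Prod>l<r. \<Sum>i\<in>UNIV. \<Sum>j\<in>UNIV. f (Suc l) i j)"
    unfolding Suc[symmetric] by (simp flip: sum_distrib_left sum_distrib_right)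
  finally show ?case unfolding prod.lessThan_Suc_shift by simp
qed

text \<open>This is the shape of \<^const>\<open>tensorB\<close>: the ambient multi-indices \<open>I\<close>, \<open>J\<close> are
  contracted with the metric, and what remains is a sum over the indices \<open>p\<close>, \<open>q\<close> on the
  submanifold.\<close>

lemma sum_product_contraction:
  fixes \<alpha> \<beta> :: "_ \<Rightarrow> real"
  shows "(\<Sum>I\<in>A. \<Sum>J\<in>B. (\<Sum>p\<in>P. \<alpha> p * \<phi> p I) * (\<Sum>q\<in>Q. \<beta> q * \<psi> q J) * \<gamma> I J)
    = (\<Sum>p\<in>P. \<Sum>q\<in>Q. \<alpha> p * \<beta> q * (\<Sum>I\<in>A. \<Sum>J\<in>B. \<phi> p I * \<psi> q J * \<gamma> I J))"
proof -
  let ?F = "\<lambda>I J p q. \<alpha> p * \<beta> q * (\<phi> p I * \<psi> q J * \<gamma> I J)"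
  have "(\<Sum>I\<in>A. \<Sum>J\<in>B. (\<Sum>p\<in>P. \<alpha> p * \<phi> p I) * (\<Sum>q\<in>Q. \<beta> q * \<psi> q J) * \<gamma> I J)
    = (\<Sum>I\<in>A. \<Sum>J\<in>B. \<Sum>p\<in>P. \<Sum>q\<in>Q. ?F I J p q)"
    by (intro sum.cong refl, unfold sum_product, unfold sum_distrib_right, intro sum.cong refl)
      (simp add: mult_ac)
  also have "\<dots> = (\<Sum>I\<in>A. \<Sum>p\<in>P. \<Sum>J\<in>B. \<Sum>q\<in>Q. ?F I J p q)"
    by (intro sum.cong refl sum.swap)
  also have "\<dots> = (\<Sum>p\<in>P. \<Sum>I\<in>A. \<Sum>J\<in>B. \<Sum>q\<in>Q. ?F I J p q)"
    by (rule sum.swap)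
  also have "\<dots> = (\<Sum>p\<in>P. \<Sum>I\<in>A. \<Sum>q\<in>Q. \<Sum>J\<in>B. ?F I J p q)"
    by (intro sum.cong refl sum.swap)
  also have "\<dots> = (\<Sum>p\<in>P. \<Sum>q\<in>Q. \<Sum>I\<in>A. \<Sum>J\<in>B. ?F I J p q)"
    by (intro sum.cong refl sum.swap)
  finally show ?thesis by (simp add: sum_distrib_left)
qed

text \<open>Up to the factor \<open>(n-1)!\<close> this is the cofactor of \<open>h\<close> at \<open>(a, b)\<close>. The sum
  over pairs of lists is the form in which it arises when the two Levi-Civita symbols in
  \<^const>\<open>tensorP\<close> and \<^const>\<open>tensorT\<close> meet.\<close>

definition minor_sum :: "real^'n::{finite, linorder}^'n::_ \<Rightarrow> 'n::_ \<Rightarrow> 'n \<Rightarrow> real"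
  where "minor_sum h a b = (\<Sum>as\<in>multi_indices (CARD('n) - 1). \<Sum>bs\<in>multi_indices (CARD('n) - 1).
    levi_civita (a # as) * levi_civita (b # bs) * (\<Prod>l<CARD('n) - 1. h $ (as ! l) $ (bs ! l)))"

text \<open>Laplace expansion. Prepending \<open>a\<close> and \<open>c\<close> to the lists turns the sum over \<open>a\<close> and
  \<open>as\<close> into that of \<open>levi_civita_determinant\<close>, which yields \<open>det h\<close> times the symbol of
  \<open>c # bs\<close>; the remaining sum over \<open>bs\<close> is \<open>levi_civita_contraction\<close>.\<close>

lemma minor_sum_contraction:
  fixes h :: "real^'n::{finite, linorder}^'n::_"
  shows "(\<Sum>a\<in>UNIV. minor_sum h a b * h $ a $ c) = (if b = c then fact (CARD('n) - 1) * det h else 0)"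
proof -
  obtain r where n: "CARD('n) = Suc r" using zero_less_card_finite[where 'a = 'n] gr0_implies_Suc by blast
  have h: "(\<chi> a b. h $ a $ b) = h" by simp
  have "(\<Sum>a\<in>UNIV. minor_sum h a b * h $ a $ c)
    = (\<Sum>a\<in>UNIV. \<Sum>as\<in>multi_indices r. \<Sum>bs\<in>multi_indices r. levi_civita (b # bs) *
        (levi_civita (a # as) * (h $ a $ c * (\<Prod>l<r. h $ (as ! l) $ (bs ! l)))))"
    unfolding minor_sum_def n by (simp add: sum_distrib_left mult_ac)
  also have "\<dots> = (\<Sum>a\<in>UNIV. \<Sum>bs\<in>multi_indices r. \<Sum>as\<in>multi_indices r. levi_civita (b # bs) *
        (levi_civita (a # as) * (h $ a $ c * (\<Prod>l<r. h $ (as ! l) $ (bs ! l)))))"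
    by (intro sum.cong refl sum.swap)
  also have "\<dots> = (\<Sum>bs\<in>multi_indices r. \<Sum>a\<in>UNIV. \<Sum>as\<in>multi_indices r. levi_civita (b # bs) *
        (levi_civita (a # as) * (h $ a $ c * (\<Prod>l<r. h $ (as ! l) $ (bs ! l)))))"
    by (rule sum.swap)
  also have "\<dots> = (\<Sum>bs\<in>multi_indices r. levi_civita (b # bs) * (\<Sum>a\<in>UNIV. \<Sum>as\<in>multi_indices r.
        levi_civita (a # as) * (h $ a $ c * (\<Prod>l<r. h $ (as ! l) $ (bs ! l)))))"
    by (simp add: sum_distrib_left)
  also have "\<dots> = (\<Sum>bs\<in>multi_indices r. levi_civita (b # bs) * (levi_civita (c # bs) * det h))"
  proof (rule sum.cong[OF refl])
    fix bs :: "'n list" assume "bs \<in> multi_indices r"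
    then have "length (c # bs) = CARD('n)" by (simp add: n multi_indices_def)
    from levi_civita_determinant[OF this, of "\<lambda>a b. h $ a $ b"]
    show "levi_civita (b # bs) * (\<Sum>a\<in>UNIV. \<Sum>as\<in>multi_indices r.
        levi_civita (a # as) * (h $ a $ c * (\<Prod>l<r. h $ (as ! l) $ (bs ! l))))
      = levi_civita (b # bs) * (levi_civita (c # bs) * det h)"
      unfolding n sum_multi_indices_Suc prod.lessThan_Suc_shift h by simp
  qed
  also have "\<dots> = (\<Sum>bs\<in>multi_indices r. levi_civita (b # bs) * levi_civita (c # bs)) * det h"
    by (simp add: sum_distrib_left mult_ac)
  finally show ?thesis
    using levi_civita_contraction[of b c] unfolding n by simp
qed

section \<open>The map B in terms of the covariant derivatives\<close>

lemma tensorP_eq: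
  fixes x :: "real^'n::{finite, linorder} \<Rightarrow> real^'m"
  assumes n: "CARD('n) = Suc r" and I: "I \<in> multi_indices r"
  shows "tensorP x \<rho> i I u = 1 / (sqrt (fact r) * \<rho> u) *
    (\<Sum>(a, as)\<in>UNIV \<times> multi_indices r. levi_civita (a # as) * tangent_basis x a u $ i *
      (\<Prod>l<r. tangent_basis x (as ! l) u $ (I ! l)))"
  unfolding tensorP_def bracket_def n sum_multi_indices_Suc prod.lessThan_Suc_shift
  using I by (simp add: tangent_basis_def multi_indices_def sum.cartesian_product mult_ac)

text \<open>Moving the free index of the Levi-Civita symbol from the end to the front costs
  \<open>(-1)^(n-1)\<close>, which together with the sign \<open>(-1)^n\<close> in the definition leaves the overall
  minus sign of Weingarten's formula.\<close>

lemma tensorT_eq: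
  fixes x :: "real^'n::{finite, linorder} \<Rightarrow> real^'m"
  assumes n: "CARD('n) = Suc r"
  shows "tensorT x G \<rho> V J k u = - 1 / (sqrt (fact r) * \<rho> u) *
    (\<Sum>(b, bs)\<in>UNIV \<times> multi_indices r. levi_civita (b # bs) * cov_deriv x G b V u $ k *
      (\<Prod>l<r. tangent_basis x (bs ! l) u $ (J ! l)))"
proof -
  have "(\<Sum>bs\<in>multi_indices r. \<Sum>b\<in>UNIV. levi_civita (bs @ [b]) / \<rho> u *
      (\<Prod>l<r. partial (bs ! l) (\<lambda>u. x u $ (J ! l)) u) * cov_deriv x G b V u $ k)
    = (\<Sum>bs\<in>multi_indices r. \<Sum>b\<in>UNIV. (-1) ^ r / \<rho> u * (levi_civita (b # bs) * cov_deriv x G b V u $ k *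
      (\<Prod>l<r. tangent_basis x (bs ! l) u $ (J ! l))))"
    by (intro sum.cong refl)
      (simp add: multi_indices_def tangent_basis_def levi_civita_rotate[where xs = "[]", simplified])
  also have "\<dots> = (\<Sum>b\<in>UNIV. \<Sum>bs\<in>multi_indices r. (-1) ^ r / \<rho> u * (levi_civita (b # bs) * cov_deriv x G b V u $ k *
      (\<Prod>l<r. tangent_basis x (bs ! l) u $ (J ! l))))"
    by (rule sum.swap)
  also have "\<dots> = (-1) ^ r / \<rho> u * (\<Sum>(b, bs)\<in>UNIV \<times> multi_indices r. levi_civita (b # bs) * cov_deriv x G b V u $ k *
      (\<Prod>l<r. tangent_basis x (bs ! l) u $ (J ! l)))"
    by (simp add: sum.cartesian_product sum_distrib_left case_prod_unfold)
  finally show ?thesis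
    unfolding tensorT_def n by (simp flip: power_mult_distrib power_add mult_2)
qed

text \<open>Contracting the tangent components with the ambient metric turns each product over
  \<open>n-1\<close> factors into the corresponding product of entries of the induced metric.\<close>

lemma tensorB_eq:
  fixes x :: "real^'n::{finite, linorder} \<Rightarrow> real^'m"
  shows "tensorB x G \<rho> V i k u = - 1 / (fact (CARD('n) - 1) * (\<rho> u)\<^sup>2) *
    (\<Sum>a\<in>UNIV. \<Sum>b\<in>UNIV. minor_sum (induced_metric x G u) a b *
      tangent_basis x a u $ i * cov_deriv x G b V u $ k)"
proof -
  obtain r where n: "CARD('n) = Suc r" using zero_less_card_finite[where 'a = 'n] gr0_implies_Suc by blast
  let ?E = "\<lambda>a. tangent_basis x a u" and ?D = "\<lambda>b. cov_deriv x G b V u" and ?g = "G (x u)"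
    and ?h = "induced_metric x G u" and ?\<kappa> = "- 1 / (fact r * (\<rho> u)\<^sup>2)"
    and ?MI = "multi_indices r :: 'm list set" and ?P = "UNIV \<times> multi_indices r :: ('n \<times> 'n list) set"
  have gram: "(\<Sum>I\<in>?MI. \<Sum>J\<in>?MI. (\<Prod>l<r. ?E (as ! l) $ (I ! l)) * (\<Prod>l<r. ?E (bs ! l) $ (J ! l)) *
      (\<Prod>l<r. ?g $ (I ! l) $ (J ! l))) = (\<Prod>l<r. ?h $ (as ! l) $ (bs ! l))" for as bs
    using sum_multi_indices_prod[where r = r and f = "\<lambda>l i j. ?E (as ! l) $ i * ?E (bs ! l) $ j * ?g $ i $ j"]
    by (simp add: prod.distrib induced_metric_def metric_inner_def mult_ac)
  have pairs: "(\<Sum>p\<in>?P. F p) = (\<Sum>a\<in>UNIV. \<Sum>as\<in>multi_indices r. F (a, as))"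
    for F :: "'n \<times> 'n list \<Rightarrow> real"
    by (simp add: sum.cartesian_product)
  have "tensorB x G \<rho> V i k u
    = (\<Sum>I\<in>?MI. \<Sum>J\<in>?MI. ?\<kappa> *
        ((\<Sum>p\<in>?P. (levi_civita (fst p # snd p) * ?E (fst p) $ i) * (\<Prod>l<r. ?E (snd p ! l) $ (I ! l))) *
         (\<Sum>q\<in>?P. (levi_civita (fst q # snd q) * ?D (fst q) $ k) * (\<Prod>l<r. ?E (snd q ! l) $ (J ! l))) *
         (\<Prod>l<r. ?g $ (I ! l) $ (J ! l))))"
    unfolding tensorB_def n diff_Suc_1
    by (intro sum.cong refl)
      (simp add: tensorP_eq[OF n] tensorT_eq[OF n] case_prod_unfold power2_eq_square)
  also have "\<dots> = ?\<kappa> * (\<Sum>p\<in>?P. \<Sum>q\<in>?P. (levi_civita (fst p # snd p) * ?E (fst p) $ i) *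
      (levi_civita (fst q # snd q) * ?D (fst q) $ k) * (\<Prod>l<r. ?h $ (snd p ! l) $ (snd q ! l)))"
    unfolding sum_distrib_left[symmetric] sum_product_contraction gram ..
  also have "\<dots> = ?\<kappa> * (\<Sum>a\<in>UNIV. \<Sum>as\<in>multi_indices r. \<Sum>b\<in>UNIV. \<Sum>bs\<in>multi_indices r.
      levi_civita (a # as) * levi_civita (b # bs) * (\<Prod>l<r. ?h $ (as ! l) $ (bs ! l)) * (?E a $ i * ?D b $ k))"
    unfolding pairs by (simp add: mult_ac)
  also have "\<dots> = ?\<kappa> * (\<Sum>a\<in>UNIV. \<Sum>b\<in>UNIV. \<Sum>as\<in>multi_indices r. \<Sum>bs\<in>multi_indices r.
      levi_civita (a # as) * levi_civita (b # bs) * (\<Prod>l<r. ?h $ (as ! l) $ (bs ! l)) * (?E a $ i * ?D b $ k))"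
    by (intro arg_cong[where f = "\<lambda>t. ?\<kappa> * t"] sum.cong refl sum.swap)
  finally show ?thesis
    unfolding minor_sum_def n diff_Suc_1 sum_distrib_right by (simp add: mult_ac)
qed

text \<open>In particular the image of \<^const>\<open>mapB\<close> is tangent to the submanifold.\<close>

lemma mapB_eq:
  fixes x :: "real^'n::{finite, linorder} \<Rightarrow> real^'m"
  shows "mapB x G \<rho> V u X = (- 1 / (fact (CARD('n) - 1) * (\<rho> u)\<^sup>2)) *\<^sub>R
    (\<Sum>a\<in>UNIV. \<Sum>b\<in>UNIV. (minor_sum (induced_metric x G u) a b *
      metric_inner (G (x u)) (cov_deriv x G b V u) X) *\<^sub>R tangent_basis x a u)"
proof (rule vec_eq_iff[THEN iffD2, rule_format])
  fix i
  let ?E = "\<lambda>a. tangent_basis x a u" and ?D = "\<lambda>b. cov_deriv x G b V u" and ?g = "G (x u)"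
    and ?K = "minor_sum (induced_metric x G u)" and ?\<kappa> = "- 1 / (fact (CARD('n) - 1) * (\<rho> u)\<^sup>2)"
  have "mapB x G \<rho> V u X $ i = ?\<kappa> * (\<Sum>k\<in>UNIV. \<Sum>j\<in>UNIV. \<Sum>a\<in>UNIV. \<Sum>b\<in>UNIV.
      ?K a b * ?E a $ i * (?g $ k $ j * ?D b $ k * X $ j))"
    by (simp only: mapB_def tensorB_eq vec_lambda_beta)
      (simp add: sum_distrib_left sum_distrib_right mult_ac)
  also have "\<dots> = ?\<kappa> * (\<Sum>k\<in>UNIV. \<Sum>a\<in>UNIV. \<Sum>j\<in>UNIV. \<Sum>b\<in>UNIV.
      ?K a b * ?E a $ i * (?g $ k $ j * ?D b $ k * X $ j))"
    by (intro arg_cong[where f = "\<lambda>t. ?\<kappa> * t"] sum.cong refl sum.swap)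
  also have "\<dots> = ?\<kappa> * (\<Sum>a\<in>UNIV. \<Sum>k\<in>UNIV. \<Sum>j\<in>UNIV. \<Sum>b\<in>UNIV.
      ?K a b * ?E a $ i * (?g $ k $ j * ?D b $ k * X $ j))"
    by (intro arg_cong[where f = "\<lambda>t. ?\<kappa> * t"] sum.swap)
  also have "\<dots> = ?\<kappa> * (\<Sum>a\<in>UNIV. \<Sum>k\<in>UNIV. \<Sum>b\<in>UNIV. \<Sum>j\<in>UNIV.
      ?K a b * ?E a $ i * (?g $ k $ j * ?D b $ k * X $ j))"
    by (intro arg_cong[where f = "\<lambda>t. ?\<kappa> * t"] sum.cong refl sum.swap)
  also have "\<dots> = ?\<kappa> * (\<Sum>a\<in>UNIV. \<Sum>b\<in>UNIV. \<Sum>k\<in>UNIV. \<Sum>j\<in>UNIV.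
      ?K a b * ?E a $ i * (?g $ k $ j * ?D b $ k * X $ j))"
    by (intro arg_cong[where f = "\<lambda>t. ?\<kappa> * t"] sum.cong refl sum.swap)
  also have "\<dots> = ?\<kappa> * (\<Sum>a\<in>UNIV. \<Sum>b\<in>UNIV. ?K a b * metric_inner ?g (?D b) X * ?E a $ i)"
    by (simp add: metric_inner_def sum_distrib_left sum_distrib_right mult_ac)
  finally show "mapB x G \<rho> V u X $ i
    = (?\<kappa> *\<^sub>R (\<Sum>a\<in>UNIV. \<Sum>b\<in>UNIV. (?K a b * metric_inner ?g (?D b) X) *\<^sub>R ?E a)) $ i"
    by simp
qed

section \<open>The Levi-Civita connection along the submanifold\<close>

text \<open>Lowering the upper index cancels the inverse metric in the definition and leaves the Christoffel
  symbols of the first kind.\<close>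

lemma christoffel_lower:
  fixes G :: "real^'m \<Rightarrow> real^'m^'m"
  assumes "invertible (G y)"
  shows "(\<Sum>i\<in>UNIV. G y $ l $ i * christoffel G y i j k) = 1/2 *
    (partial j (\<lambda>y. G y $ l $ k) y + partial k (\<lambda>y. G y $ l $ j) y - partial l (\<lambda>y. G y $ j $ k) y)"
proof -
  let ?c = "\<lambda>m. partial j (\<lambda>y. G y $ m $ k) y + partial k (\<lambda>y. G y $ m $ j) y - partial m (\<lambda>y. G y $ j $ k) y"
  have "G y ** matrix_inv (G y) = mat 1"
    using assms someI_ex[of "\<lambda>A'. G y ** A' = mat 1 \<and> A' ** G y = mat 1"]
    unfolding invertible_def matrix_inv_def by blast
  then have inv: "(\<Sum>i\<in>UNIV. G y $ l $ i * matrix_inv (G y) $ i $ m) = (if l = m then 1 else 0)" for m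
    by (simp add: matrix_matrix_mult_def mat_def vec_eq_iff)
  have "(\<Sum>i\<in>UNIV. G y $ l $ i * christoffel G y i j k)
    = (\<Sum>i\<in>UNIV. \<Sum>m\<in>UNIV. 1/2 * (G y $ l $ i * matrix_inv (G y) $ i $ m * ?c m))"
    unfolding christoffel_def by (simp add: sum_distrib_left mult_ac)
  also have "\<dots> = (\<Sum>m\<in>UNIV. \<Sum>i\<in>UNIV. 1/2 * (G y $ l $ i * matrix_inv (G y) $ i $ m * ?c m))"
    by (rule sum.swap)
  also have "\<dots> = (\<Sum>m\<in>UNIV. 1/2 * ((\<Sum>i\<in>UNIV. G y $ l $ i * matrix_inv (G y) $ i $ m) * ?c m))"
    by (simp only: sum_distrib_left sum_distrib_right)
  also have "\<dots> = 1/2 * ?c l"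
    unfolding inv by (simp add: if_distrib[where f = "\<lambda>t. t * _"] flip: sum_divide_distrib cong: if_cong)
  finally show ?thesis .
qed

lemma metric_inner_connection:
  assumes "transpose g = g"
  shows "metric_inner g (\<chi> i. \<Sum>j\<in>UNIV. \<Sum>k\<in>UNIV. \<Gamma> i j k * p $ j * V $ k) W
    = (\<Sum>l\<in>UNIV. \<Sum>j\<in>UNIV. \<Sum>k\<in>UNIV. (\<Sum>i\<in>UNIV. g $ l $ i * \<Gamma> i j k) * p $ j * V $ k * W $ l)"
proof -
  let ?F = "\<lambda>l i j k. g $ l $ i * \<Gamma> i j k * p $ j * V $ k * W $ l"
  have "metric_inner g (\<chi> i. \<Sum>j\<in>UNIV. \<Sum>k\<in>UNIV. \<Gamma> i j k * p $ j * V $ k) W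
    = (\<Sum>l\<in>UNIV. \<Sum>i\<in>UNIV. \<Sum>j\<in>UNIV. \<Sum>k\<in>UNIV. ?F l i j k)"
    unfolding metric_inner_commute[OF assms, of _ W]
    unfolding metric_inner_def vec_lambda_beta sum_distrib_left by (simp only: mult_ac)
  also have "\<dots> = (\<Sum>l\<in>UNIV. \<Sum>j\<in>UNIV. \<Sum>i\<in>UNIV. \<Sum>k\<in>UNIV. ?F l i j k)"
    by (intro sum.cong refl sum.swap)
  also have "\<dots> = (\<Sum>l\<in>UNIV. \<Sum>j\<in>UNIV. \<Sum>k\<in>UNIV. \<Sum>i\<in>UNIV. ?F l i j k)"
    by (intro sum.cong refl sum.swap)
  finally show ?thesis by (simp only: sum_distrib_right)
qed

lemma partial_metric_symmetric:
  assumes "open S" "y \<in> S" "\<forall>z\<in>S. transpose (G z) = G z" "G differentiable (at y)"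
  shows "partial l (\<lambda>z. G z $ i $ j) y = partial l (\<lambda>z. G z $ j $ i) y"
proof (rule partial_transform[OF _ assms(1,2)])
  show "(\<lambda>z. G z $ i $ j) differentiable (at y)"
    by (rule differentiable_nth[OF differentiable_nth[OF assms(4)]])
  show "G z $ i $ j = G z $ j $ i" if "z \<in> S" for z
  proof -
    have "transpose (G z) $ j $ i = G z $ j $ i" using assms(3) that by simp
    then show ?thesis by (simp add: transpose_def)
  qed
qed

lemma cov_deriv_eq:
  assumes "V differentiable (at u)"
  shows "cov_deriv x G a V u = partial a V u +
    (\<chi> i. \<Sum>j\<in>UNIV. \<Sum>k\<in>UNIV. christoffel G (x u) i j k * tangent_basis x a u $ j * V u $ k)"
  by (simp add: cov_deriv_def vec_eq_iff partial_nth[OF assms] tangent_basis_def)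

lemma tangent_basis_eq: "x differentiable (at u) \<Longrightarrow> tangent_basis x a u = partial a x u"
  by (simp add: tangent_basis_def vec_eq_iff partial_nth)

text \<open>The connection is compatible with the metric. By the product and chain rules the derivative of
  the inner product consists of the terms with the derivatives of \<open>V\<close> and \<open>W\<close>, which are
  the flat parts of the covariant derivatives, and a term with the derivative of \<open>G\<close>. The latter
  equals the contribution of the Christoffel symbols, since the symbols of the first kind satisfy
  \<open>C l j k + C k j l = \<partial>\<^sub>j G\<^sub>l\<^sub>k\<close>.\<close>

lemma partial_metric_inner:
  fixes x :: "real^'n \<Rightarrow> real^'m" and G :: "real^'m \<Rightarrow> real^'m^'m"
  assumes S: "open S" "x u \<in> S" "\<forall>y\<in>S. transpose (G y) = G y"
    and G: "G differentiable (at (x u))" "invertible (G (x u))"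
    and x: "x differentiable (at u)"
    and V: "V differentiable (at u)" and W: "W differentiable (at u)"
  shows "partial a (\<lambda>v. metric_inner (G (x v)) (V v) (W v)) u
    = metric_inner (G (x u)) (cov_deriv x G a V u) (W u)
      + metric_inner (G (x u)) (V u) (cov_deriv x G a W u)"
proof -
  let ?g = "G (x u)" and ?p = "tangent_basis x a u"
  let ?dG = "\<lambda>l i j. partial l (\<lambda>y. G y $ i $ j) (x u)"
  define C where "C l j k = (\<Sum>i\<in>UNIV. ?g $ l $ i * christoffel G (x u) i j k)" for l j k
  let ?conn = "\<lambda>V. \<chi> i. \<Sum>j\<in>UNIV. \<Sum>k\<in>UNIV. christoffel G (x u) i j k * ?p $ j * V $ k"
  have sym: "transpose ?g = ?g" using S by blast
  have dG: "?dG l i j = ?dG l j i" for l i j by (rule partial_metric_symmetric[OF S G(1)])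
  have C: "C l j k + C k j l = ?dG j l k" for l j k
    unfolding C_def christoffel_lower[of G, OF G(2)] dG[of j k l] dG[of k l j] dG[of l j k]
    by (simp add: field_simps)
  have "metric_inner ?g (?conn (V u)) (W u)
    = (\<Sum>l\<in>UNIV. \<Sum>j\<in>UNIV. \<Sum>k\<in>UNIV. C l j k * ?p $ j * V u $ k * W u $ l)"
    unfolding C_def by (rule metric_inner_connection[OF sym])
  also have "\<dots> = (\<Sum>l\<in>UNIV. \<Sum>k\<in>UNIV. \<Sum>j\<in>UNIV. C l j k * ?p $ j * V u $ k * W u $ l)"
    by (intro sum.cong refl sum.swap)
  also have "\<dots> = (\<Sum>k\<in>UNIV. \<Sum>l\<in>UNIV. \<Sum>j\<in>UNIV. C l j k * ?p $ j * V u $ k * W u $ l)"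
    by (rule sum.swap)
  finally have conn_V: "metric_inner ?g (?conn (V u)) (W u)
    = (\<Sum>k\<in>UNIV. \<Sum>l\<in>UNIV. \<Sum>j\<in>UNIV. C l j k * ?p $ j * V u $ k * W u $ l)" .
  have "metric_inner ?g (V u) (?conn (W u)) = metric_inner ?g (?conn (W u)) (V u)"
    by (rule metric_inner_commute[OF sym])
  also have "\<dots> = (\<Sum>k\<in>UNIV. \<Sum>j\<in>UNIV. \<Sum>l\<in>UNIV. C k j l * ?p $ j * W u $ l * V u $ k)"
    unfolding C_def by (rule metric_inner_connection[OF sym])
  also have "\<dots> = (\<Sum>k\<in>UNIV. \<Sum>l\<in>UNIV. \<Sum>j\<in>UNIV. C k j l * ?p $ j * W u $ l * V u $ k)"
    by (intro sum.cong refl sum.swap)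
  finally have conn_W: "metric_inner ?g (V u) (?conn (W u))
    = (\<Sum>k\<in>UNIV. \<Sum>l\<in>UNIV. \<Sum>j\<in>UNIV. C k j l * ?p $ j * W u $ l * V u $ k)" .
  have "C l j k * p * v * w + C k j l * p * w * v = ?dG j k l * p * v * w" for l j k and p v w :: real
  proof -
    have "C l j k * p * v * w + C k j l * p * w * v = (C l j k + C k j l) * p * v * w"
      by (simp add: algebra_simps)
    then show ?thesis unfolding C dG[of j l k] .
  qed
  then have conn: "metric_inner ?g (?conn (V u)) (W u) + metric_inner ?g (V u) (?conn (W u))
    = (\<Sum>k\<in>UNIV. \<Sum>l\<in>UNIV. \<Sum>j\<in>UNIV. ?dG j k l * ?p $ j * V u $ k * W u $ l)"
    unfolding conn_V conn_W by (simp only: flip: sum.distrib)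
  \<comment> \<open>It remains to differentiate the coordinate expression of the inner product.\<close>
  let ?Dx = "frechet_derivative x (at u)"
  let ?DG = "\<lambda>i j. frechet_derivative (\<lambda>y. G y $ i $ j) (at (x u))"
  let ?DV = "frechet_derivative V (at u)" and ?DW = "frechet_derivative W (at u)"
  have Gij: "(\<lambda>y. G y $ i $ j) differentiable (at (x u))" for i j
    by (rule differentiable_nth[OF differentiable_nth[OF G(1)]])
  have hG: "((\<lambda>v. G (x v) $ i $ j) has_derivative (\<lambda>h. ?DG i j (?Dx h))) (at u)" for i j
    using has_derivative_compose[OF x[unfolded frechet_derivative_works] Gij[unfolded frechet_derivative_works]]
    by simp
  have hV: "((\<lambda>v. V v $ i) has_derivative (\<lambda>h. ?DV h $ i)) (at u)" for i
    using has_derivative_nth[OF V[unfolded frechet_derivative_works]] .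
  have hW: "((\<lambda>v. W v $ i) has_derivative (\<lambda>h. ?DW h $ i)) (at u)" for i
    using has_derivative_nth[OF W[unfolded frechet_derivative_works]] .
  have "((\<lambda>v. metric_inner (G (x v)) (V v) (W v)) has_derivative
    (\<lambda>h. \<Sum>i\<in>UNIV. \<Sum>j\<in>UNIV. ?g $ i $ j * V u $ i * ?DW h $ j +
      (?g $ i $ j * ?DV h $ i + ?DG i j (?Dx h) * V u $ i) * W u $ j)) (at u)"
    unfolding metric_inner_def
    by (intro has_derivative_sum has_derivative_mult hG hV hW)
  from partial_eq[OF this, of a]
  have "partial a (\<lambda>v. metric_inner (G (x v)) (V v) (W v)) u
    = metric_inner ?g (V u) (partial a W u) + metric_inner ?g (partial a V u) (W u)
      + (\<Sum>i\<in>UNIV. \<Sum>j\<in>UNIV. ?DG i j ?p * V u $ i * W u $ j)"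
    unfolding metric_inner_def tangent_basis_eq[OF x]
    by (simp add: partial_def sum.distrib algebra_simps)
  also have "(\<Sum>i\<in>UNIV. \<Sum>j\<in>UNIV. ?DG i j ?p * V u $ i * W u $ j)
    = (\<Sum>k\<in>UNIV. \<Sum>l\<in>UNIV. \<Sum>j\<in>UNIV. ?dG j k l * ?p $ j * V u $ k * W u $ l)"
    unfolding frechet_derivative_eq_sum_partial[OF Gij] sum_distrib_right by (simp add: mult_ac)
  also have "\<dots> = metric_inner ?g (?conn (V u)) (W u) + metric_inner ?g (V u) (?conn (W u))"
    by (rule conn[symmetric])
  finally show ?thesis
    unfolding cov_deriv_eq[OF V] cov_deriv_eq[OF W] metric_inner_add_left metric_inner_add_right
    by linarith
qed

text \<open>The connection is torsion free: the second derivatives of \<open>x\<close> commute, and the Christoffel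
  symbols are symmetric in their lower indices because the metric is symmetric.\<close>

lemma cov_deriv_tangent_basis_commute:
  fixes x :: "real^'n \<Rightarrow> real^'m" and G :: "real^'m \<Rightarrow> real^'m^'m"
  assumes S: "open S" "x u \<in> S" "\<forall>y\<in>S. transpose (G y) = G y"
    and G: "G differentiable (at (x u))"
    and U: "open U" "u \<in> U" "smooth_on U x"
  shows "cov_deriv x G a (tangent_basis x b) u = cov_deriv x G b (tangent_basis x a) u"
proof -
  have E: "tangent_basis x a v = partial a x v" if "v \<in> U" for a v
    by (rule tangent_basis_eq[OF smooth_on_differentiable[OF U(3) that]])
  have second: "partial a (\<lambda>v. tangent_basis x b v $ i) u = partial a (partial b x) u $ i" for a b i
  proof -
    have diff: "partial b x differentiable (at u)"
      by (intro smooth_on_differentiable[of U] smooth_on_partial U)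
    have "partial a (\<lambda>v. partial b x v $ i) u = partial a (\<lambda>v. tangent_basis x b v $ i) u"
      by (rule partial_transform[OF differentiable_nth[OF diff] U(1,2)]) (simp add: E)
    then show ?thesis by (simp add: partial_nth[OF diff])
  qed
  have \<Gamma>: "christoffel G (x u) i j k = christoffel G (x u) i k j" for i j k
    unfolding christoffel_def using partial_metric_symmetric[OF S G, of _ j k]
    by (simp add: add.commute)
  have "(\<Sum>j\<in>UNIV. \<Sum>k\<in>UNIV. christoffel G (x u) i j k * tangent_basis x a u $ j * tangent_basis x b u $ k)
    = (\<Sum>k\<in>UNIV. \<Sum>j\<in>UNIV. christoffel G (x u) i k j * tangent_basis x b u $ k * tangent_basis x a u $ j)" for i
    by (subst sum.swap) (simp add: \<Gamma>[of i] mult_ac)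
  then show ?thesis
    unfolding cov_deriv_def second partial_commute[OF U, of a b]
    by (simp add: vec_eq_iff tangent_basis_def)
qed

section \<open>Weingarten's formula\<close>

text \<open>The inner product with a tangent basis vector contracts the cofactors of the induced metric with
  the induced metric itself, which leaves its determinant.\<close>

lemma metric_inner_mapB_tangent:
  fixes x :: "real^'n::{finite, linorder} \<Rightarrow> real^'m"
  shows "metric_inner (G (x u)) (mapB x G \<rho> V u Y) (tangent_basis x c u)
    = - (det (induced_metric x G u) / (\<rho> u)\<^sup>2) * metric_inner (G (x u)) (cov_deriv x G c V u) Y"
proof -
  let ?h = "induced_metric x G u" and ?D = "\<lambda>b. metric_inner (G (x u)) (cov_deriv x G b V u) Y"
  have "(\<Sum>a\<in>UNIV. \<Sum>b\<in>UNIV. minor_sum ?h a b * ?D b * ?h $ a $ c)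
    = (\<Sum>b\<in>UNIV. \<Sum>a\<in>UNIV. minor_sum ?h a b * ?D b * ?h $ a $ c)"
    by (rule sum.swap)
  also have "\<dots> = (\<Sum>b\<in>UNIV. ?D b * (\<Sum>a\<in>UNIV. minor_sum ?h a b * ?h $ a $ c))"
    by (simp add: sum_distrib_left mult_ac)
  also have "\<dots> = fact (CARD('n) - 1) * det ?h * ?D c"
    unfolding minor_sum_contraction by (simp add: if_distrib cong: if_cong)
  finally have "(\<Sum>a\<in>UNIV. \<Sum>b\<in>UNIV. minor_sum ?h a b * ?D b * ?h $ a $ c)
    = fact (CARD('n) - 1) * det ?h * ?D c" .
  then show ?thesis
    unfolding mapB_eq metric_inner_left by (simp add: induced_metric_def)
qed

lemma metric_inner_mapB_normal:
  fixes x :: "real^'n::{finite, linorder} \<Rightarrow> real^'m"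
  assumes "\<And>a. metric_inner (G (x u)) (tangent_basis x a u) \<nu> = 0"
  shows "metric_inner (G (x u)) (mapB x G \<rho> V u Y) \<nu> = 0"
  unfolding mapB_eq metric_inner_left assms by simp

text \<open>The \<open>E a\<close> and \<open>N B\<close> together are linearly independent, since pairing with the
  \<open>N B\<close> isolates the normal coefficients. By counting dimensions they span the ambient space, so
  \<open>W\<close> is orthogonal to itself.\<close>

lemma adapted_frame_spans:
  fixes E :: "'n::finite \<Rightarrow> real^'m" and N :: "'p::finite \<Rightarrow> real^'m"
  assumes card: "CARD('m) = CARD('n) + CARD('p)"
    and sym: "transpose g = g" and pos: "\<And>v. v \<noteq> 0 \<Longrightarrow> 0 < v \<bullet> (g *v v)"
    and orthonormal: "\<And>B C. metric_inner g (N B) (N C) = (if B = C then 1 else 0)"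
    and orthogonal: "\<And>B a. metric_inner g (N B) (E a) = 0"
    and indep: "\<And>\<xi> :: real^'n. (\<Sum>a\<in>UNIV. \<xi> $ a *\<^sub>R E a) = 0 \<Longrightarrow> \<xi> = 0"
    and W: "\<And>a. metric_inner g W (E a) = 0" "\<And>B. metric_inner g W (N B) = 0"
  shows "W = 0"
proof -
  define T where "T z = (\<Sum>a\<in>UNIV. fst z $ a *\<^sub>R E a) + (\<Sum>B\<in>UNIV. snd z $ B *\<^sub>R N B)"
    for z :: "(real^'n) \<times> (real^'p)"
  have lin: "linear T"
    unfolding T_def
    by (intro linearI) (simp_all add: algebra_simps sum.distrib scaleR_sum_right)
  have inj: "z = 0" if "T z = 0" for z
  proof -
    have "snd z $ B = metric_inner g (T z) (N B)" for B
      unfolding T_def metric_inner_left orthonormal metric_inner_commute[OF sym, of "E _"] orthogonal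
      by (simp add: if_distrib cong: if_cong)
    then have "snd z = 0" by (simp add: vec_eq_iff that metric_inner_eq)
    with that have "fst z = 0" by (intro indep) (simp add: T_def)
    with \<open>snd z = 0\<close> show ?thesis by (simp add: prod_eq_iff)
  qed
  then have "inj T" using linear_injective_0[OF lin] by blast
  then have "surj T"
    by (intro linear_injective_imp_surjective[OF lin]) (simp_all add: card)
  then obtain z where "W = T z" by (metis surjD)
  then have "metric_inner g W W = 0"
    using W by (subst (2) \<open>W = T z\<close>) (simp add: T_def metric_inner_add_right metric_inner_sum_right metric_inner_scaleR_right)
  then show ?thesis using pos[of W] by (auto simp: metric_inner_eq)
qed

theorem mainTheorem3:
  fixes \<S> :: "('s::{t2_space, second_countable_topology}, 'n::{finite, linorder}) chart set"
    and \<M> :: "('a::{t2_space, second_countable_topology}, 'm::finite) chart set"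
    and gM :: "('a, 'm) chart \<Rightarrow> real^'m \<Rightarrow> real^'m^'m"
    and \<iota> :: "'s \<Rightarrow> 'a"
    and s :: "('s, 'n) chart" and c :: "('a, 'm) chart"
    and U :: "(real^'n::_) set"
    and x :: "real^'n::_ \<Rightarrow> real^'m" and G :: "real^'m \<Rightarrow> real^'m^'m"
    and \<rho> :: "real^'n::_ \<Rightarrow> real"
    and N :: "'p::finite \<Rightarrow> real^'n::_ \<Rightarrow> real^'m"
    and u \<xi> :: "real^'n::_" and X :: "real^'m" and A :: 'p
  assumes dims: "CARD('n) \<ge> 2" "CARD('m) = CARD('n) + CARD('p)"
    and manifolds: "smooth_atlas \<S>" "smooth_atlas \<M>"
    and metric: "riemannian_metric \<M> gM"
    and embedding: "smooth_embedding \<S> \<M> \<iota>"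
    and coordinates: "s \<in> \<S>" "c \<in> \<M>" "open U" "U \<subseteq> chart_rep_dom s c \<iota>"
    and x: "x = chart_rep s c \<iota>"
    and G: "G = gM c"
    and density: "\<forall>v\<in>U. \<rho> v \<noteq> 0"
    and normals_smooth: "\<forall>B. smooth_on U (N B)"
    and normals_orthonormal:
      "\<forall>v\<in>U. \<forall>B C. metric_inner (G (x v)) (N B v) (N C v) = (if B = C then 1 else 0)"
    and normals_orthogonal:
      "\<forall>v\<in>U. \<forall>B a. metric_inner (G (x v)) (N B v) (tangent_basis x a v) = 0"
    and point: "u \<in> U"
    and tangent: "X = (\<Sum>a\<in>UNIV. \<xi> $ a *\<^sub>R tangent_basis x a u)"
  shows "(density_ratio x G \<rho> u)\<^sup>2 *\<^sub>R cov_deriv_dir x G \<xi> (N A) u =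
    - mapB x G \<rho> (N A) u X +
    (\<Sum>B\<in>UNIV. metric_inner (G (x u)) (mapB x G \<rho> (N B) u (N A u)) X *\<^sub>R N B u)"
proof -
  let ?g = "G (x u)" and ?h = "induced_metric x G u" and ?E = "\<lambda>a. tangent_basis x a u"
    and ?D = "\<lambda>B a. cov_deriv x G a (N B) u" and ?S = "snd c ` fst c"
  define \<gamma> where "\<gamma> = (density_ratio x G \<rho> u)\<^sup>2"
  have "is_chart c" "is_chart s"
    using manifolds coordinates(1,2) by (auto simp: smooth_atlas_def)
  then have s_inv: "chart_inv s (snd s p) = p" if "p \<in> fst s" for p
    using that by (auto simp: is_chart_def homeomorphism_def)
  \<comment> \<open>The coordinate description: \<open>x\<close> maps \<open>U\<close> into the open image \<open>?S\<close> of the ambient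
    chart, where the metric is smooth and positive definite.\<close>
  have xS: "x v \<in> ?S" if "v \<in> U" for v
    using that coordinates(4) by (auto simp: x chart_rep_dom_def chart_rep_def s_inv)
  have openS: "open ?S" using \<open>is_chart c\<close> by (simp add: is_chart_def)
  have "smooth_on ?S G"
    and sym: "\<forall>y\<in>?S. transpose (G y) = G y"
    and pos: "\<And>y v. y \<in> ?S \<Longrightarrow> v \<noteq> 0 \<Longrightarrow> 0 < v \<bullet> (G y *v v)"
    using metric coordinates(2) unfolding riemannian_metric_def G by blast+
  then have diff_G: "G differentiable (at (x u))"
    using smooth_on_differentiable xS[OF point] by blast
  have sym_g: "transpose ?g = ?g" using sym xS[OF point] by blast
  have pos_g: "v \<noteq> 0 \<Longrightarrow> 0 < v \<bullet> (?g *v v)" for v using pos xS[OF point] by blast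
  have "v = 0" if "?g *v v = 0" for v using pos_g[of v] that by auto
  then have inv_g: "invertible ?g"
    unfolding invertible_left_inverse matrix_left_invertible_ker by blast
  have smooth_x: "smooth_on U x" and "inj (frechet_derivative x (at u))"
    using embedding coordinates point smooth_on_subset
    unfolding smooth_embedding_def x by blast+
  have diff_x: "x differentiable (at v)" if "v \<in> U" for v
    using smooth_on_differentiable[OF smooth_x that] .
  have diff_N: "N B differentiable (at u)" for B
    using normals_smooth smooth_on_differentiable point by blast
  have diff_E: "tangent_basis x a differentiable (at u)" for a
  proof -
    have "partial a x differentiable (at u)"
      by (rule smooth_on_differentiable[OF smooth_on_partial[OF smooth_x] point])
    then show ?thesis
      unfolding differentiable_def
      using has_derivative_transform_within_open[OF _ coordinates(3) point] tangent_basis_eq[OF diff_x]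
      by metis
  qed
  have indep: "\<eta> = 0" if "(\<Sum>a\<in>UNIV. \<eta> $ a *\<^sub>R ?E a) = 0" for \<eta>
  proof -
    have lin: "linear (frechet_derivative x (at u))"
      by (rule linear_frechet_derivative[OF diff_x[OF point]])
    have "frechet_derivative x (at u) \<eta> = 0"
      using that unfolding frechet_derivative_eq_sum_partial[OF diff_x[OF point]]
        tangent_basis_eq[OF diff_x[OF point]] .
    then show ?thesis
      using \<open>inj _\<close> linear_injective_0[OF lin] by blast
  qed
  have orthonormal: "metric_inner ?g (N B u) (N C u) = (if B = C then 1 else 0)" for B C
    using normals_orthonormal point by blast
  have orthogonal: "metric_inner ?g (N B u) (?E a) = 0" for B a
    using normals_orthogonal point by blast

  \<comment> \<open>The inner products of the frame are constant on \<open>U\<close>; differentiating them gives the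
    antisymmetry of the normal connection and the symmetry of the second fundamental form.\<close>
  have skew: "metric_inner ?g (?D B a) (N C u) = - metric_inner ?g (?D C a) (N B u)" for B C a
  proof -
    have "partial a (\<lambda>v. metric_inner (G (x v)) (N B v) (N C v)) u = partial a (\<lambda>v. if B = C then 1 else 0) u"
      by (rule partial_transform[symmetric, OF _ coordinates(3) point]) (use normals_orthonormal in auto)
    also have "\<dots> = 0" by (simp add: partial_def)
    finally show ?thesis
      unfolding partial_metric_inner[OF openS xS[OF point] sym diff_G inv_g diff_x[OF point] diff_N diff_N]
        metric_inner_commute[OF sym_g, of "N B u"] by linarith
  qed
  have "metric_inner ?g (?D B a) (?E b) = - metric_inner ?g (N B u) (cov_deriv x G a (tangent_basis x b) u)" for B a b
  proof -
    have "partial a (\<lambda>v. metric_inner (G (x v)) (N B v) (tangent_basis x b v)) u = partial a (\<lambda>v. 0) u"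
      by (rule partial_transform[symmetric, OF _ coordinates(3) point]) (use normals_orthogonal in auto)
    also have "\<dots> = 0" by (simp add: partial_def)
    finally show ?thesis
      unfolding partial_metric_inner[OF openS xS[OF point] sym diff_G inv_g diff_x[OF point] diff_N diff_E]
      by linarith
  qed
  then have shape_symmetric: "metric_inner ?g (?D B a) (?E b) = metric_inner ?g (?D B b) (?E a)" for B a b
    using cov_deriv_tangent_basis_commute[OF openS xS[OF point] sym diff_G coordinates(3) point smooth_x, of a b]
    by simp

  \<comment> \<open>The square of \<open>sqrt (det ?h)\<close> is \<open>det ?h\<close> only because a Gram determinant is
    nonnegative.\<close>
  have \<gamma>: "\<gamma> = det ?h / (\<rho> u)\<^sup>2"
  proof -
    have "v \<bullet> (?h *v v) = metric_inner ?g (\<Sum>a\<in>UNIV. v $ a *\<^sub>R ?E a) (\<Sum>b\<in>UNIV. v $ b *\<^sub>R ?E b)" for v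
      unfolding metric_inner_sum_left metric_inner_scaleR_left metric_inner_sum_right metric_inner_scaleR_right
      by (simp add: inner_vec_def matrix_vector_mult_def induced_metric_def sum_distrib_left mult_ac
        metric_inner_commute[OF sym_g, of "?E _" "?E _"])
    moreover have "0 \<le> metric_inner ?g w w" for w
      using pos_g[of w] by (cases "w = 0") (auto simp: metric_inner_eq)
    ultimately have "0 \<le> det ?h" by (intro det_nonneg) simp
    then show ?thesis by (simp add: \<gamma>_def density_ratio_def power_divide)
  qed
  note B_tangent = metric_inner_mapB_tangent[of G x u \<rho>, folded \<gamma>]
  have B_normal: "metric_inner ?g (mapB x G \<rho> V u Y) (N B u) = 0" for V Y B
    by (rule metric_inner_mapB_normal) (simp add: metric_inner_commute[OF sym_g, of "?E _"] orthogonal)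
  have B_tangent_X: "metric_inner ?g (mapB x G \<rho> (N B) u Y) X
    = - \<gamma> * (\<Sum>a\<in>UNIV. \<xi> $ a * metric_inner ?g (?D B a) Y)" for B Y
    unfolding tangent metric_inner_sum_right metric_inner_scaleR_right B_tangent
    by (simp add: sum_distrib_left mult_ac sum_negf)

  \<comment> \<open>\<open>W\<close> is the difference of the two sides; it is orthogonal to the whole frame.\<close>
  define W where "W = \<gamma> *\<^sub>R cov_deriv_dir x G \<xi> (N A) u + mapB x G \<rho> (N A) u X
    - (\<Sum>B\<in>UNIV. metric_inner ?g (mapB x G \<rho> (N B) u (N A u)) X *\<^sub>R N B u)"
  have "W = 0"
  proof (rule adapted_frame_spans[OF dims(2) sym_g pos_g orthonormal orthogonal indep])
    fix b
    have "metric_inner ?g (?D A b) X = (\<Sum>a\<in>UNIV. \<xi> $ a * metric_inner ?g (?D A a) (?E b))"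
      unfolding tangent metric_inner_sum_right metric_inner_scaleR_right shape_symmetric[where B = A and a = b] ..
    then show "metric_inner ?g W (?E b) = 0"
      unfolding W_def cov_deriv_dir_def metric_inner_left B_tangent orthogonal by simp
  next
    fix C
    have "(\<Sum>B\<in>UNIV. metric_inner ?g (mapB x G \<rho> (N B) u (N A u)) X * metric_inner ?g (N B u) (N C u))
      = metric_inner ?g (mapB x G \<rho> (N C) u (N A u)) X"
      unfolding orthonormal by (simp add: if_distrib cong: if_cong)
    also have "\<dots> = \<gamma> * (\<Sum>a\<in>UNIV. \<xi> $ a * metric_inner ?g (?D A a) (N C u))"
      unfolding B_tangent_X skew[where B = C and C = A] by (simp add: sum_negf)
    finally show "metric_inner ?g W (N C u) = 0"
      unfolding W_def cov_deriv_dir_def metric_inner_left B_normal by simp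
  qed
  then show ?thesis unfolding W_def \<gamma>_def by (simp add: algebra_simps)
qed

end
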